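(* Let $k\ge 1$ and $L=\lceil \frac{k+3}{2}\rceil$. Let $\mathbf U_h^C$ be, componentwise, a polynomial of degree at most $k$ on each primal cell $I_j=(x_{j-\frac12},x_{j+\frac12})$, and let $\mathbf U_h^D$ be, componentwise, a polynomial of degree at most $k$ on each dual cell $I_{j+\frac12}=(x_j,x_{j+1})$ (both with values in $\mathbb R^8$). Assume that the cell averages satisfy $\overline{\mathbf U}_j^C\in G$ and $\overline{\mathbf U}_{j+\frac12}^D\in G$ for all $j$, that $$\mathbf U_h^C(x)\in G,\qquad \mathbf U_h^D(x)\in G\qquad \forall x\in \bigcup_j \hat{\mathbb Q}_j^x ,$$ and that there is a constant $\mathrm B_{\rm const}$ such that $$B_{1,h}^D(x_{j\pm\frac12})=\mathrm B_{\rm const}=B_{1,h}^C(x_{j\pm1})\qquad\forall j .$$ Let $\Delta t>0$, $\tau_{\max}>0$ satisfy $$a_1\frac{\Delta t}{\Delta x}<\frac{\theta\hat\omega_1}{2},\qquad \theta:=\frac{\Delta t}{\tau_{\max}}\in(0,1],$$ where $$a_1:=\max_j\Big\{\alpha_1\big(\mathbf U_h^C(x_{j+1}),\mathbf U_h^C(x_j)\big),\ \alpha_1\big(\mathbf U_h^D(x_{j+\frac12}),\mathbf U_h^D(x_{j-\frac12})\big)\Big\}.$$ Then for all $j$, $$\overline{\mathbf U}_j^C+\Delta t\,\mathcal L_j(\mathbf U_h^C,\mathbf U_h^D)\in G,\qquad \overline{\mathbf U}_{j+\frac12}^D+\Delta t\,\mathcal L_{j+\frac12}(\mathbf U_h^D,\mathbf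 U_h^C)\in G .$$
   Context: **Ideal MHD.** States are $\mathbf U=(\rho,\mathbf m,\mathbf B,E)^\top\in\mathbb R^8$ with $\mathbf m,\mathbf B\in\mathbb R^3$. Put $\mathbf v=\mathbf m/\rho$, $\mathcal E(\mathbf U)=E-\frac{|\mathbf m|^2}{2\rho}-\frac{|\mathbf B|^2}{2}=\rho e$ (this defines the specific internal energy $e$), and $p=p(\rho,e)$ given by an equation of state for which $p>0\Leftrightarrow e>0$ (when $\rho>0$). The flux in direction $i$ is $$\mathbf F_i(\mathbf U)=\Big(\rho v_i,\ v_i\mathbf m-B_i\mathbf B+(p+\tfrac12|\mathbf B|^2)\mathbf e_i,\ v_i\mathbf B-B_i\mathbf v,\ v_i(E+p+\tfrac12|\mathbf B|^2)-B_i(\mathbf v\cdot\mathbf B)\Big)^\top,$$ with $\mathbf e_i$ the $i$th column of the $3\times3$ identity matrix. The admissible set is $G=\{\mathbf U:\rho>0,\ \mathcal E(\mathbf U)>0\}$. **Wave speed bound.** For $\mathbf U,\tilde{\mathbf U}\in G$ (tilde denotes quantities of $\tilde{\mathbf U}$), $$\alpha_i(\mathbf U,\tilde{\mathbf U})=\max\Big\{|v_i|+\mathcal C_i,\ |\tilde v_i|+\tilde{\mathcal C}_i,\ \frac{|\sqrt\rho v_i+\sqrt{\tilde\rho}\tilde v_i|}{\sqrt\rho+\sqrt{\tilde\rho}}+\max\{\mathcal C_i,\tilde{\mathcal C}_i\}\Big\}+\frac{|\mathbf B-\tilde{\mathbf B}|}{\sqrt\rho+\sqrt{\tilde\rho}},$$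 $$\mathcal C_i=\frac1{\sqrt2}\Big[\frac{|\mathbf B|^2}{\rho}+\mathcal C_s^2+\sqrt{\big(\tfrac{|\mathbf B|^2}{\rho}+\mathcal C_s^2\big)^2-4\tfrac{B_i^2\mathcal C_s^2}{\rho}}\Big]^{1/2},\qquad \mathcal C_s=\frac{p}{\rho\sqrt{2e}} .$$ **Meshes.** The 1D domain is divided uniformly into $I_j=(x_{j-\frac12},x_{j+\frac12})$ of length $\Delta x$, with midpoints $x_j$; the dual cells are $I_{j+\frac12}=(x_j,x_{j+1})$. The index $j$ ranges over all mesh indices; any values needed beyond the boundary are supplied by boundary conditions and are subject to the same hypotheses. $B_{1,h}^C,B_{1,h}^D$ denote the $B_1$-components of $\mathbf U_h^C,\mathbf U_h^D$. **Quadrature.** $\{\hat x^{(\nu)}_{j-\frac14}\}_{\nu=1}^L$ and $\{\hat x^{(\nu)}_{j+\frac14}\}_{\nu=1}^L$ are the $L$-point Gauss–Lobatto nodes (endpoints included) on $[x_{j-\frac12},x_j]$ and $[x_j,x_{j+\frac12}]$, $\hat{\mathbb Q}_j^x$ is their union, and $\hat\omega_\nu$ are the associated weights normalized by $\sum_{\nu=1}^L\hat\omega_\nu=1$ (so $\hat\omega_1=\hat\omega_L$). At a node where the piecewise polynomial is discontinuous, the value is understood as the one-sided limit from within the half-cell to which the node belongs (both one-sided limits when the node belongs to both adjacent half-cells). **Cell averages and scheme.** For $\star\in\{C,D\}$, $\overline{\mathbf U}_j^\star=\frac1{\Delta x}\int_{I_j}\mathbf U_h^\star\,dx$ and $\overline{\mathbf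 U}_{j+\frac12}^\star=\frac1{\Delta x}\int_{I_{j+\frac12}}\mathbf U_h^\star\,dx$. The cell-averaged standard central discontinuous Galerkin operators are $$\mathcal L_j(\mathbf U_h^C,\mathbf U_h^D)=\frac{\overline{\mathbf U}_j^D-\overline{\mathbf U}_j^C}{\tau_{\max}}-\frac{\mathbf F_1(\mathbf U_h^D(x_{j+\frac12}))-\mathbf F_1(\mathbf U_h^D(x_{j-\frac12}))}{\Delta x},$$ $$\mathcal L_{j+\frac12}(\mathbf U_h^D,\mathbf U_h^C)=\frac{\overline{\mathbf U}_{j+\frac12}^C-\overline{\mathbf U}_{j+\frac12}^D}{\tau_{\max}}-\frac{\mathbf F_1(\mathbf U_h^C(x_{j+1}))-\mathbf F_1(\mathbf U_h^C(x_j))}{\Delta x}.$$ *)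

theory Defs
  imports "HOL-Analysis.Analysis" "HOL-Computational_Algebra.Polynomial"
begin

section \<open>Ideal MHD\<close>

text \<open>The state space of dimension 8, as tuples (density, momentum, magnetic field, total energy).\<close>

type_synonym state = "real \<times> (real^3) \<times> (real^3) \<times> real"

definition density :: "state \<Rightarrow> real" where
  "density U = fst U"

definition momentum :: "state \<Rightarrow> real^3" where
  "momentum U = fst (snd U)"

definition magnetic :: "state \<Rightarrow> real^3" where
  "magnetic U = fst (snd (snd U))"

definition energy :: "state \<Rightarrow> real" where
  "energy U = snd (snd (snd U))"

definition velocity :: "state \<Rightarrow> real^3" where
  "velocity U = (1 / density U) *\<^sub>R momentum U"

text \<open>Internal energy per unit volume, and per unit mass.\<close>

definition internal_energy :: "state \<Rightarrow> real" where
  "internal_energy U =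
     energy U - (norm (momentum U))\<^sup>2 / (2 * density U) - (norm (magnetic U))\<^sup>2 / 2"

definition specific_energy :: "state \<Rightarrow> real" where
  "specific_energy U = internal_energy U / density U"

definition admissible :: "state set" where
  "admissible = {U. density U > 0 \<and> internal_energy U > 0}"

text \<open>An equation of state is a function \<open>p\<close> of density and specific internal energy.\<close>

definition eos :: "(real \<Rightarrow> real \<Rightarrow> real) \<Rightarrow> bool" where
  "eos p \<longleftrightarrow> (\<forall>\<rho> e. \<rho> > 0 \<longrightarrow> (p \<rho> e > 0 \<longleftrightarrow> e > 0))"

definition pressure :: "(real \<Rightarrow> real \<Rightarrow> real) \<Rightarrow> state \<Rightarrow> real" where
  "pressure p U = p (density U) (specific_energy U)"

definition flux :: "(real \<Rightarrow> real \<Rightarrow> real) \<Rightarrow> 3 \<Rightarrow> state \<Rightarrow> state" where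
  "flux p i U =
     (let \<rho> = density U; m = momentum U; B = magnetic U; v = velocity U;
          ptot = pressure p U + (norm B)\<^sup>2 / 2
      in (\<rho> * v $ i,
          (v $ i) *\<^sub>R m - (B $ i) *\<^sub>R B + ptot *\<^sub>R axis i 1,
          (v $ i) *\<^sub>R B - (B $ i) *\<^sub>R v,
          (v $ i) * (energy U + ptot) - (B $ i) * (v \<bullet> B)))"

definition sound_speed :: "(real \<Rightarrow> real \<Rightarrow> real) \<Rightarrow> state \<Rightarrow> real" where
  "sound_speed p U = pressure p U / (density U * sqrt (2 * specific_energy U))"

definition fast_speed :: "(real \<Rightarrow> real \<Rightarrow> real) \<Rightarrow> 3 \<Rightarrow> state \<Rightarrow> real" where
  "fast_speed p i U =
     (let \<rho> = density U; B = magnetic U; c = sound_speed p U; s = (norm B)\<^sup>2 / \<rho> + c\<^sup>2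
      in 1 / sqrt 2 * sqrt (s + sqrt (s\<^sup>2 - 4 * ((B $ i)\<^sup>2 * c\<^sup>2 / \<rho>))))"

definition wave_speed :: "(real \<Rightarrow> real \<Rightarrow> real) \<Rightarrow> 3 \<Rightarrow> state \<Rightarrow> state \<Rightarrow> real" where
  "wave_speed p i U U' =
     (let v = velocity U $ i; v' = velocity U' $ i;
          c = fast_speed p i U; c' = fast_speed p i U';
          r = sqrt (density U); r' = sqrt (density U')
      in Max {\<bar>v\<bar> + c, \<bar>v'\<bar> + c', \<bar>r * v + r' * v'\<bar> / (r + r') + max c c'}
         + norm (magnetic U - magnetic U') / (r + r'))"


section \<open>Gauss--Lobatto quadrature\<close>

text \<open>Legendre polynomials, by the formula of Rodrigues.\<close>

definition legendre_poly :: "nat \<Rightarrow> real poly" where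
  "legendre_poly n = smult (1 / (2 ^ n * fact n)) ((pderiv ^^ n) ([:-1, 0, 1:] ^ n))"

text \<open>The nodes of the rule with \<open>L \<ge> 2\<close> points on the reference interval \<open>[-1, 1]\<close>.\<close>

definition lobatto_nodes :: "nat \<Rightarrow> real set" where
  "lobatto_nodes L = {-1, 1} \<union> {\<xi>. poly (pderiv (legendre_poly (L - 1))) \<xi> = 0}"

text \<open>
  The interpolatory weight of the node \<open>\<xi>\<close>: the integral over \<open>[-1, 1]\<close> of the Lagrange basis
  polynomial, halved so that the weights add up to 1. As the weights are indexed by the nodes
  themselves, the weight of the first node is \<open>lobatto_weight L (-1)\<close>.
\<close>

definition lobatto_weight :: "nat \<Rightarrow> real \<Rightarrow> real" where
  "lobatto_weight L \<xi> =
     1 / 2 * integral {-1..1} (\<lambda>t. \<Prod>\<eta>\<in>lobatto_nodes L - {\<xi>}. (t - \<eta>) / (\<xi> - \<eta>))"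

text \<open>The nodes transported to \<open>[a, b]\<close>.\<close>

definition quad_nodes :: "nat \<Rightarrow> real \<Rightarrow> real \<Rightarrow> real set" where
  "quad_nodes L a b = (\<lambda>\<xi>. a + (b - a) * (\<xi> + 1) / 2) ` lobatto_nodes L"

text \<open>
  All values of \<open>U\<close> at the nodes on \<open>[a, b]\<close> are admissible. The value at a node is the limit from
  within \<open>(a, b)\<close>; at a point of \<open>(a, b)\<close>, where the functions in question are continuous, this is
  the value of \<open>U\<close>, and at an end point it is the one-sided limit.
\<close>

definition admissible_at_nodes :: "nat \<Rightarrow> (real \<Rightarrow> state) \<Rightarrow> real \<Rightarrow> real \<Rightarrow> bool" where
  "admissible_at_nodes L U a b \<longleftrightarrow>
     (\<forall>y\<in>quad_nodes L a b. Lim (at y within {a<..<b}) U \<in> admissible)"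


section \<open>Meshes and the central discontinuous Galerkin operators\<close>

text \<open>
  The point with index \<open>r\<close>, where \<open>r\<close> is an integer or a half-integer. The dual cell with index
  \<open>j\<close> is the one centred at the point with index \<open>j + 1/2\<close>.
\<close>

definition grid :: "real \<Rightarrow> real \<Rightarrow> real \<Rightarrow> real" where
  "grid x\<^sub>0 dx r = x\<^sub>0 + r * dx"

definition primal_cell :: "real \<Rightarrow> real \<Rightarrow> int \<Rightarrow> real set" where
  "primal_cell x\<^sub>0 dx j = {grid x\<^sub>0 dx (j - 1/2) <..< grid x\<^sub>0 dx (j + 1/2)}"

definition dual_cell :: "real \<Rightarrow> real \<Rightarrow> int \<Rightarrow> real set" where
  "dual_cell x\<^sub>0 dx j = {grid x\<^sub>0 dx j <..< grid x\<^sub>0 dx (j + 1)}"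

definition componentwise_poly_on :: "nat \<Rightarrow> real set \<Rightarrow> (real \<Rightarrow> state) \<Rightarrow> bool" where
  "componentwise_poly_on k I U \<longleftrightarrow>
     (\<forall>b\<in>Basis. \<exists>q :: real poly. degree q \<le> k \<and> (\<forall>x\<in>I. U x \<bullet> b = poly q x))"

definition cell_average :: "real \<Rightarrow> real set \<Rightarrow> (real \<Rightarrow> state) \<Rightarrow> state" where
  "cell_average dx I U = (1 / dx) *\<^sub>R integral I U"

definition cdg_primal ::
  "(real \<Rightarrow> real \<Rightarrow> real) \<Rightarrow> real \<Rightarrow> real \<Rightarrow> real \<Rightarrow> (real \<Rightarrow> state) \<Rightarrow> (real \<Rightarrow> state) \<Rightarrow> int \<Rightarrow> state" where
  "cdg_primal p x\<^sub>0 dx \<tau> UC UD j =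
     (1 / \<tau>) *\<^sub>R (cell_average dx (primal_cell x\<^sub>0 dx j) UD - cell_average dx (primal_cell x\<^sub>0 dx j) UC)
     - (1 / dx) *\<^sub>R (flux p 1 (UD (grid x\<^sub>0 dx (j + 1/2))) - flux p 1 (UD (grid x\<^sub>0 dx (j - 1/2))))"

definition cdg_dual ::
  "(real \<Rightarrow> real \<Rightarrow> real) \<Rightarrow> real \<Rightarrow> real \<Rightarrow> real \<Rightarrow> (real \<Rightarrow> state) \<Rightarrow> (real \<Rightarrow> state) \<Rightarrow> int \<Rightarrow> state" where
  "cdg_dual p x\<^sub>0 dx \<tau> UD UC j =
     (1 / \<tau>) *\<^sub>R (cell_average dx (dual_cell x\<^sub>0 dx j) UC - cell_average dx (dual_cell x\<^sub>0 dx j) UD)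
     - (1 / dx) *\<^sub>R (flux p 1 (UC (grid x\<^sub>0 dx (j + 1))) - flux p 1 (UC (grid x\<^sub>0 dx j)))"

text \<open>
  The constant \<open>a\<^sub>1\<close> of the CFL condition on the mesh with primal cells \<open>1, \<dots>, N\<close> and dual cells
  \<open>0, \<dots>, N\<close>; the primal function is also used on the ghost cells \<open>0\<close> and \<open>N + 1\<close>.
\<close>

definition max_wave_speed ::
  "(real \<Rightarrow> real \<Rightarrow> real) \<Rightarrow> real \<Rightarrow> real \<Rightarrow> int \<Rightarrow> (real \<Rightarrow> state) \<Rightarrow> (real \<Rightarrow> state) \<Rightarrow> real" where
  "max_wave_speed p x\<^sub>0 dx N UC UD =
     Max ((\<lambda>j::int. wave_speed p 1 (UC (grid x\<^sub>0 dx (j + 1))) (UC (grid x\<^sub>0 dx j))) ` {0..N} \<union>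
          (\<lambda>j::int. wave_speed p 1 (UD (grid x\<^sub>0 dx (j + 1/2))) (UD (grid x\<^sub>0 dx (j - 1/2)))) ` {1..N})"

end

theory Submission
  imports Defs
begin

text \<open>
  The admissible set is the intersection of \<open>\<rho> > 0\<close> with the half-spaces
  \<open>\<rho> \<bar>v\<bar>\<^sup>2/2 - v \<cdot> m - b \<cdot> B + E + \<bar>b\<bar>\<^sup>2/2 > 0\<close> over all \<open>v, b\<close>, hence convex. Tested against such
  a functional, the difference of two fluxes with the same normal magnetic field is at most the
  wave speed times the sum of the functionals of the two states, so
  \<open>(U + V - (F U - F V) / a) / 2\<close> is admissible whenever \<open>a\<close> exceeds the wave speed. The
  Gauss--Lobatto rule is exact for the piecewise polynomials and has nonnegative weights, so the
  cell average of the other solution is a convex combination of its nodal values; its two end point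
  values absorb the flux difference, and the update is a convex combination of admissible states.
\<close>

section \<open>Supporting half-spaces of the admissible set and the fast speed\<close>

text \<open>Internal energy and pressure are nonlinear in the state, while the scheme only adds
  states and fluxes; a form linear in the state can be applied to both. The constant |b|^2/2 is
  therefore kept outside of it. This term sees the state only through the normal field B_i, so it
  cancels between two states with equal B_i; this is what the common value \<open>Bconst\<close> is
  for. The two states to be paired are the values at the end points of a cell. The other solution is
  smooth there and breaks at the midpoint, so the rule is applied on each half-cell, and the two
  outer end points are split off with the same weight. That is why the symmetry of the weights is
  proved.\<close>

definition support_form :: "real^3 \<Rightarrow> real^3 \<Rightarrow> state \<Rightarrow> real" where
  "support_form v b U = density U * (norm v)\<^sup>2 / 2 - v \<bullet> momentum U - b \<bullet> magnetic U + energy U"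

lemma density_add [simp]: "density (U + V) = density U + density V"
  and density_diff [simp]: "density (U - V) = density U - density V"
  and density_scaleR [simp]: "density (c *\<^sub>R U) = c * density U"
  by (simp_all add: density_def)

lemma support_form_add: "support_form v b (U + V) = support_form v b U + support_form v b V"
  by (simp add: support_form_def density_def momentum_def magnetic_def energy_def
      inner_add_right field_simps)

lemma support_form_diff: "support_form v b (U - V) = support_form v b U - support_form v b V"
  by (simp add: support_form_def density_def momentum_def magnetic_def energy_def
      inner_diff_right field_simps)

lemma support_form_scaleR: "support_form v b (c *\<^sub>R U) = c * support_form v b U"
  by (simp add: support_form_def density_def momentum_def magnetic_def energy_def field_simps)

lemma momentum_eq: "density U > 0 \<Longrightarrow> momentum U = density U *\<^sub>R velocity U"
  by (simp add: velocity_def)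

text \<open>Completing the squares in \<open>v\<close> and \<open>b\<close>. Positivity on
  admissible states becomes visible, and so does the optimal test \<open>v = velocity U\<close>,
  \<open>b = magnetic U\<close>, where exactly the internal energy remains.\<close>

lemma support_form_eq:
  assumes "density U > 0"
  shows "support_form v b U + (norm b)\<^sup>2 / 2 =
    density U * (norm (velocity U - v))\<^sup>2 / 2 + (norm (magnetic U - b))\<^sup>2 / 2 + internal_energy U"
  using assms
  unfolding support_form_def internal_energy_def momentum_eq[OF assms] power2_norm_eq_inner
  by (simp add: inner_diff_left inner_diff_right inner_commute field_simps)

lemma admissible_iff_support_form:
  "U \<in> admissible \<longleftrightarrow> density U > 0 \<and> (\<forall>v b. support_form v b U + (norm b)\<^sup>2 / 2 > 0)"
proof
  assume U: "U \<in> admissible"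
  then have "density U > 0" "internal_energy U > 0" by (auto simp: admissible_def)
  then show "density U > 0 \<and> (\<forall>v b. support_form v b U + (norm b)\<^sup>2 / 2 > 0)"
    by (auto simp: support_form_eq intro!: add_nonneg_pos)
next
  assume U: "density U > 0 \<and> (\<forall>v b. support_form v b U + (norm b)\<^sup>2 / 2 > 0)"
  then have "support_form (velocity U) (magnetic U) U + (norm (magnetic U))\<^sup>2 / 2 > 0" by blast
  with U show "U \<in> admissible" by (simp add: support_form_eq admissible_def)
qed

lemma convex_admissible: "convex admissible"
  unfolding convex_def
proof (intro ballI allI impI)
  fix U V :: state and s t :: real
  assume UV: "U \<in> admissible" "V \<in> admissible" and st: "0 \<le> s" "0 \<le> t" "s + t = 1"
  have pos: "s * x + t * y > 0" if "x > 0" "y > 0" for x y :: real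
    using st that by (metis add_cancel_right_left add_nonneg_pos add_pos_nonneg le_less
        mult_pos_pos mult_zero_left zero_less_one mult_nonneg_nonneg less_imp_le)
  have "support_form v b (s *\<^sub>R U + t *\<^sub>R V) + (norm b)\<^sup>2 / 2
      = s * (support_form v b U + (norm b)\<^sup>2 / 2) + t * (support_form v b V + (norm b)\<^sup>2 / 2)" for v b
  proof -
    have "(norm b)\<^sup>2 / 2 = (s + t) * ((norm b)\<^sup>2 / 2)" using st by simp
    then show ?thesis by (simp add: support_form_add support_form_scaleR algebra_simps)
  qed
  then show "s *\<^sub>R U + t *\<^sub>R V \<in> admissible"
    using UV by (auto simp: admissible_iff_support_form intro!: pos)
qed

text \<open>Grouped by the estimate that each piece receives: transport with the speed of the state
  itself, a stress part for \<open>fast_speed_bound\<close>, magnetic energy carried by the test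
  velocity, and a rest that sees the state only through \<open>B $ i\<close>.\<close>

lemma flux_support_form:
  fixes v b :: "real^3"
  assumes "density U > 0"
  defines "w \<equiv> velocity U - v" and "c \<equiv> magnetic U - b" and "B \<equiv> magnetic U"
  shows "support_form v b (flux p i U) =
      velocity U $ i * (density U * (norm w)\<^sup>2 / 2 + internal_energy U)
      + (pressure p U * w $ i + (w $ i *\<^sub>R B - B $ i *\<^sub>R w) \<bullet> c)
      + v $ i * (norm c)\<^sup>2 / 2
      + B $ i * (v \<bullet> b) - v $ i * (norm b)\<^sup>2 / 2"
proof -
  define u where "u = velocity U"
  have m: "momentum U = density U *\<^sub>R u" using assms(1) by (simp add: momentum_eq u_def)
  have E: "energy U = internal_energy U + density U * (u \<bullet> u) / 2 + (B \<bullet> B) / 2"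
    using assms(1) unfolding internal_energy_def m B_def power2_norm_eq_inner
    by (simp add: field_simps)
  show ?thesis
    unfolding support_form_def flux_def Let_def w_def c_def
    unfolding m E u_def[symmetric] B_def[symmetric]
    by (simp add: density_def[of "(_,_)"] momentum_def[of "(_,_)"] magnetic_def[of "(_,_)"]
        energy_def[of "(_,_)"] inner_axis' inner_axis power2_norm_eq_inner inner_diff_left inner_diff_right inner_add_left
        inner_add_right inner_commute field_simps)
qed

section \<open>The fast speed as the constant of a quadratic inequality\<close>

lemma inner_transversal_squared_le:
  fixes x y :: "real^'n"
  shows "(x \<bullet> y - x $ i * y $ i)\<^sup>2 \<le> ((norm x)\<^sup>2 - (x $ i)\<^sup>2) * ((norm y)\<^sup>2 - (y $ i)\<^sup>2)"
proof -
  \<comment> \<open>\<open>P\<close> deletes component \<open>i\<close>; the claim is Cauchy-Schwarz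
    for the projected vectors.\<close>
  define P where "P z = z - z $ i *\<^sub>R axis i 1" for z :: "real^'n"
  have *: "P z \<bullet> P z' = z \<bullet> z' - z $ i * z' $ i" for z z'
    by (simp add: P_def inner_diff_left inner_diff_right inner_axis inner_axis' inner_axis_axis)
  have "(P x \<bullet> P y)\<^sup>2 \<le> (P x \<bullet> P x) * (P y \<bullet> P y)"
    by (rule Cauchy_Schwarz_ineq)
  then show ?thesis unfolding * power2_norm_eq_inner power2_eq_square[of "_ $ i"] .
qed

lemma component_squared_le_norm_squared: "(x $ i)\<^sup>2 \<le> (norm (x :: real^'n))\<^sup>2"
  using component_le_norm_cart[of x i] by (simp add: abs_le_square_iff[symmetric])

lemma fast_speed_nonneg: "density U > 0 \<Longrightarrow> fast_speed p i U \<ge> 0"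
proof -
  assume "density U > 0"
  define s P where "s = (norm (magnetic U))\<^sup>2 / density U + (sound_speed p U)\<^sup>2"
    and "P = 4 * ((magnetic U $ i)\<^sup>2 * (sound_speed p U)\<^sup>2 / density U)"
  have "s \<ge> 0" using \<open>density U > 0\<close> by (simp add: s_def)
  \<comment> \<open>\<open>sqrt\<close> of a negative number is negative here, so the sign of the
    inner radicand has to be settled first.\<close>
  have "P \<le> s\<^sup>2"
  proof -
    let ?x = "(magnetic U $ i)\<^sup>2 / density U" and ?c = "(sound_speed p U)\<^sup>2"
    have "4 * (?x * ?c) \<le> (?x + ?c)\<^sup>2"
      using zero_le_power2[of "?x - ?c"] unfolding power2_diff power2_sum by linarith
    also have "?x + ?c \<le> s"
      using \<open>density U > 0\<close> component_squared_le_norm_squared[of "magnetic U" i]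
      by (simp add: s_def divide_right_mono)
    then have "(?x + ?c)\<^sup>2 \<le> s\<^sup>2"
      using \<open>density U > 0\<close> by (intro power_mono) auto
    finally show ?thesis by (simp add: P_def)
  qed
  then show ?thesis
    using \<open>s \<ge> 0\<close> by (simp add: fast_speed_def Let_def s_def P_def)
qed

text \<open>The square of the fast speed is the larger root \<open>\<lambda>\<close> of
  \<open>(\<lambda> - \<bar>B\<^sub>\<bottom>\<bar>\<^sup>2/\<rho> - c\<^sup>2) (\<lambda> - B\<^sub>i\<^sup>2/\<rho>) = B\<^sub>i\<^sup>2 \<bar>B\<^sub>\<bottom>\<bar>\<^sup>2/\<rho>\<^sup>2\<close>, stated here with the
  denominators cleared.\<close>

lemma fast_speed_root:
  fixes p U i
  assumes \<rho>: "density U > 0"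
  defines "\<Lambda> \<equiv> density U * (fast_speed p i U)\<^sup>2" and "Bi \<equiv> (magnetic U $ i)\<^sup>2"
    and "M \<equiv> (norm (magnetic U))\<^sup>2 - (magnetic U $ i)\<^sup>2"
    and "S \<equiv> density U * (sound_speed p U)\<^sup>2"
  shows "\<Lambda> \<ge> M + S" "\<Lambda> \<ge> Bi" "(\<Lambda> - M - S) * (\<Lambda> - Bi) = Bi * M"
proof -
  define r where "r = density U"
  have r: "r > 0" using \<rho> by (simp add: r_def)
  define x m c where "x = Bi / r" and "m = M / r" and "c = (sound_speed p U)\<^sup>2"
  have nn: "x \<ge> 0" "m \<ge> 0" "c \<ge> 0"
    using r component_squared_le_norm_squared[of "magnetic U" i] by (auto simp: x_def m_def c_def Bi_def M_def)
  define s d where "s = x + m + c" and "d = sqrt (s\<^sup>2 - 4 * (x * c))"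
  \<comment> \<open>The discriminant in a second form, a sum of nonnegative terms. It yields
    \<open>\<bar>m + c - x\<bar> \<le> d\<close>, which puts the larger root above both
    \<open>m + c\<close> and \<open>x\<close>.\<close>
  have s2: "(m + c - x)\<^sup>2 + 4 * (x * m) = s\<^sup>2 - 4 * (x * c)"
    by (simp add: s_def power2_eq_square algebra_simps)
  have xm: "x * m \<ge> 0" using nn by simp
  then have nn2: "s\<^sup>2 - 4 * (x * c) \<ge> 0"
    using zero_le_power2[of "m + c - x"] s2 by linarith
  have d2: "d\<^sup>2 = (m + c - x)\<^sup>2 + 4 * (x * m)"
    unfolding s2 d_def using nn2 by simp
  have "\<bar>m + c - x\<bar> \<le> d"
    unfolding d_def using s2 xm by (intro real_le_rsqrt) simp
  have "(norm (magnetic U))\<^sup>2 / r + c = s" "(magnetic U $ i)\<^sup>2 * c / r = x * c"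
    by (simp_all add: s_def x_def m_def Bi_def M_def diff_divide_distrib)
  then have fs: "fast_speed p i U = 1 / sqrt 2 * sqrt (s + d)"
    by (simp add: fast_speed_def Let_def r_def c_def d_def)
  have "s \<ge> 0" "d \<ge> 0" using nn nn2 by (auto simp: s_def d_def)
  then have lam: "(fast_speed p i U)\<^sup>2 = (s + d) / 2"
    by (simp add: fs power_mult_distrib power_divide)
  have \<Lambda>: "\<Lambda> = r * ((s + d) / 2)" by (simp only: \<Lambda>_def lam r_def)
  have MS: "M + S = r * (m + c)" "Bi = r * x" "M = r * m" "S = r * c"
    using r by (simp_all add: m_def x_def S_def c_def r_def distrib_left)
  show "\<Lambda> \<ge> M + S" unfolding \<Lambda> MS(1) using r \<open>\<bar>m + c - x\<bar> \<le> d\<close> by (simp add: s_def)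
  show "\<Lambda> \<ge> Bi" unfolding \<Lambda> MS(2) using r \<open>\<bar>m + c - x\<bar> \<le> d\<close> by (simp add: s_def)
  have "((s + d) / 2 - m - c) * ((s + d) / 2 - x) = x * m"
    using d2 by (simp add: s_def power2_eq_square field_simps)
  then have "r * r * (((s + d) / 2 - m - c) * ((s + d) / 2 - x)) = r * r * (x * m)" by simp
  then show "(\<Lambda> - M - S) * (\<Lambda> - Bi) = Bi * M"
    unfolding \<Lambda> MS(2-4) by (simp add: algebra_simps)
qed

text \<open>Right minus left side is a quadratic expression in \<open>w $ i\<close> and the part of
  \<open>w\<close> orthogonal to axis \<open>i\<close>. Its diagonal coefficients are the two
  factors of the root equation in \<open>fast_speed_root\<close>, and that equation says that their
  product is just enough to absorb the mixed term.\<close>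

lemma fast_speed_bound_transversal:
  fixes w :: "real^3"
  assumes \<rho>: "density U > 0"
  shows "(norm (w $ i *\<^sub>R magnetic U - magnetic U $ i *\<^sub>R w))\<^sup>2
          + density U * (sound_speed p U)\<^sup>2 * (w $ i)\<^sup>2
         \<le> (fast_speed p i U)\<^sup>2 * (density U * (norm w)\<^sup>2)"
proof -
  define B \<Lambda> S M W t where "B = magnetic U" and "\<Lambda> = density U * (fast_speed p i U)\<^sup>2"
    and "S = density U * (sound_speed p U)\<^sup>2" and "M = (norm B)\<^sup>2 - (B $ i)\<^sup>2"
    and "W = (norm w)\<^sup>2 - (w $ i)\<^sup>2" and "t = B \<bullet> w - B $ i * w $ i"
  note root = fast_speed_root[OF \<rho>, where p = p and i = i, folded B_def, folded M_def S_def \<Lambda>_def]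
  have W: "W \<ge> 0" using component_squared_le_norm_squared[of w i] by (simp add: W_def)
  have t2: "t\<^sup>2 \<le> M * W" unfolding t_def M_def W_def by (rule inner_transversal_squared_le)
  define a c where "a = (\<Lambda> - M - S) * (w $ i)\<^sup>2" and "c = (\<Lambda> - (B $ i)\<^sup>2) * W"
  have ac: "a \<ge> 0" "c \<ge> 0" using root W by (auto simp: a_def c_def)
  have "(2 * (w $ i * B $ i * t))\<^sup>2 = 4 * ((w $ i)\<^sup>2 * (B $ i)\<^sup>2) * t\<^sup>2"
    by (simp add: power_mult_distrib)
  also have "\<dots> \<le> 4 * ((w $ i)\<^sup>2 * (B $ i)\<^sup>2) * (M * W)"
    by (rule mult_left_mono[OF t2]) simp
  also have "\<dots> = 4 * ((w $ i)\<^sup>2 * W) * ((B $ i)\<^sup>2 * M)" by simp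
  also have "\<dots> = 4 * a * c" by (simp add: root(3)[symmetric] a_def c_def del: mult_cancel_left mult_cancel_right)
  also have "\<dots> \<le> (a + c)\<^sup>2"
    using zero_le_power2[of "a - c"] by (simp add: power2_eq_square algebra_simps)
  finally have "\<bar>2 * (w $ i * B $ i * t)\<bar> \<le> a + c"
    using ac by (metis abs_le_square_iff abs_of_nonneg add_nonneg_nonneg)
  then have "- (2 * (w $ i * B $ i * t)) \<le> a + c" by linarith
  moreover have "(norm (w $ i *\<^sub>R B - B $ i *\<^sub>R w))\<^sup>2
      = (w $ i)\<^sup>2 * M + (B $ i)\<^sup>2 * W - 2 * (w $ i * B $ i * t)"
    unfolding M_def W_def t_def power2_norm_eq_inner
    by (simp add: inner_diff_left inner_diff_right inner_commute[of w B] power2_eq_square algebra_simps)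
  moreover have "(fast_speed p i U)\<^sup>2 * (density U * (norm w)\<^sup>2) = \<Lambda> * ((w $ i)\<^sup>2 + W)"
    by (simp add: \<Lambda>_def W_def)
  ultimately show ?thesis
    unfolding B_def[symmetric] S_def[symmetric] a_def c_def by (simp add: algebra_simps)
qed

text \<open>With z = sqrt (2 * internal energy), the definition of the sound speed gives p w_i = S
  z, so the left side is the inner product of \<open>(a, S)\<close> and \<open>(c, z)\<close>:
  internal energy acts as one more field component. Cauchy-Schwarz, the previous lemma for the norm
  of \<open>(a, S)\<close>, and XY <= (X^2 + Y^2)/2 finish.\<close>

lemma fast_speed_bound:
  fixes w c :: "real^3"
  assumes "eos p" and U: "U \<in> admissible"
  shows "\<bar>pressure p U * w $ i + (w $ i *\<^sub>R magnetic U - magnetic U $ i *\<^sub>R w) \<bullet> c\<bar>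
    \<le> fast_speed p i U * (density U * (norm w)\<^sup>2 / 2 + (norm c)\<^sup>2 / 2 + internal_energy U)"
proof -
  have \<rho>: "density U > 0" and ie: "internal_energy U > 0" using U by (auto simp: admissible_def)
  define a S z where "a = w $ i *\<^sub>R magnetic U - magnetic U $ i *\<^sub>R w"
    and "S = sqrt (density U) * sound_speed p U * w $ i" and "z = sqrt (2 * internal_energy U)"
  have e: "specific_energy U = internal_energy U / density U" by (simp add: specific_energy_def)
  have "pressure p U = density U * sqrt (2 * specific_energy U) * sound_speed p U"
    using \<rho> ie by (simp add: sound_speed_def e)
  also have "density U * sqrt (2 * specific_energy U) = sqrt (density U) * z"
    using \<rho> ie by (simp add: e z_def real_sqrt_mult real_sqrt_divide field_simps)
  finally have "pressure p U * w $ i = S * z" by (simp add: S_def)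
  define X Y where "X = sqrt (density U * (norm w)\<^sup>2)" and "Y = sqrt ((norm c)\<^sup>2 + z\<^sup>2)"
  have z2: "z\<^sup>2 = 2 * internal_energy U" using ie by (simp add: z_def)
  have "\<bar>pressure p U * w $ i + a \<bullet> c\<bar> = \<bar>(a, S) \<bullet> (c, z)\<bar>"
    by (simp add: \<open>pressure p U * w $ i = S * z\<close> add.commute)
  also have "\<dots> \<le> norm (a, S) * norm (c, z)" by (rule Cauchy_Schwarz_ineq2)
  also have "\<dots> = sqrt ((norm a)\<^sup>2 + S\<^sup>2) * Y" by (simp add: norm_prod_def Y_def)
  also have "sqrt ((norm a)\<^sup>2 + S\<^sup>2) \<le> sqrt ((fast_speed p i U)\<^sup>2 * (density U * (norm w)\<^sup>2))"
    using fast_speed_bound_transversal[OF \<rho>, of w i p] \<rho>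
    by (simp add: a_def S_def power_mult_distrib)
  also have "\<dots> = fast_speed p i U * X"
    using fast_speed_nonneg[OF \<rho>] by (simp add: real_sqrt_mult X_def)
  finally have "\<bar>pressure p U * w $ i + a \<bullet> c\<bar> \<le> fast_speed p i U * (X * Y)"
    by (simp add: Y_def mult_right_mono mult.assoc)
  also have "X * Y \<le> (X\<^sup>2 + Y\<^sup>2) / 2"
    using zero_le_power2[of "X - Y"] by (simp add: power2_diff)
  also have "(X\<^sup>2 + Y\<^sup>2) / 2 = density U * (norm w)\<^sup>2 / 2 + (norm c)\<^sup>2 / 2 + internal_energy U"
    using \<rho> ie by (simp add: X_def Y_def z2 add_divide_distrib)
  finally show ?thesis
    using fast_speed_nonneg[OF \<rho>, of p i] by (simp add: a_def mult_left_mono)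
qed

section \<open>The flux difference of two states\<close>

lemma support_form_pos:
  "U \<in> admissible \<Longrightarrow> support_form v b U + (norm b)\<^sup>2 / 2 > 0"
  by (simp add: admissible_iff_support_form)


text \<open>The factorization |c|^2 - |c'|^2 = (c - c') . (c + c') extracts the jump. For
  \<open>r\<close>, \<open>r'\<close> the square roots of the densities, the other factors are
  bounded by kinetic and magnetic energy.\<close>

lemma cross_term_bound:
  fixes w w' c c' :: "real^3" and r r' :: real
  shows "\<bar>(r * w $ i + r' * w' $ i) * (((norm c)\<^sup>2 - (norm c')\<^sup>2) / 2)\<bar>
    \<le> norm (c - c') * (r\<^sup>2 * (norm w)\<^sup>2 / 2 + (norm c)\<^sup>2 / 2 + (r'\<^sup>2 * (norm w')\<^sup>2 / 2 + (norm c')\<^sup>2 / 2))"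
proof -
  define x y where "x = \<bar>r * w $ i + r' * w' $ i\<bar>" and "y = norm (c + c')"
  have "\<bar>(norm c)\<^sup>2 - (norm c')\<^sup>2\<bar> = \<bar>(c - c') \<bullet> (c + c')\<bar>"
    by (simp add: power2_norm_eq_inner inner_diff_left inner_diff_right inner_add_right inner_commute)
  also have "\<dots> \<le> norm (c - c') * y" unfolding y_def by (rule Cauchy_Schwarz_ineq2)
  finally have cc: "\<bar>(norm c)\<^sup>2 - (norm c')\<^sup>2\<bar> \<le> norm (c - c') * y" .
  have "(s + t)\<^sup>2 \<le> 2 * (s\<^sup>2 + t\<^sup>2)" for s t :: real
    using zero_le_power2[of "s - t"] by (simp add: power2_diff power2_sum)
  then have "x\<^sup>2 \<le> 2 * ((r * w $ i)\<^sup>2 + (r' * w' $ i)\<^sup>2)"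
    unfolding x_def power2_abs .
  also have "\<dots> \<le> 2 * (r\<^sup>2 * (norm w)\<^sup>2 + r'\<^sup>2 * (norm w')\<^sup>2)"
    unfolding power_mult_distrib
    by (intro mult_left_mono add_mono component_squared_le_norm_squared) auto
  finally have x2: "x\<^sup>2 \<le> 2 * (r\<^sup>2 * (norm w)\<^sup>2 + r'\<^sup>2 * (norm w')\<^sup>2)" .
  have y2: "y\<^sup>2 \<le> 2 * ((norm c)\<^sup>2 + (norm c')\<^sup>2)"
    using zero_le_power2[of "norm (c - c')"] unfolding y_def power2_norm_eq_inner
    by (simp add: inner_diff_left inner_diff_right inner_add_left inner_add_right)
  \<comment> \<open>The quarter compensates the factors 2 in \<open>x2\<close> and
    \<open>y2\<close>, so the jump enters with constant 1.\<close>
  have "x * y / 2 \<le> (x\<^sup>2 + y\<^sup>2) / 4"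
    using zero_le_power2[of "x - y"] unfolding power2_diff by simp
  with x2 y2 have xy: "x * y / 2
      \<le> r\<^sup>2 * (norm w)\<^sup>2 / 2 + (norm c)\<^sup>2 / 2 + (r'\<^sup>2 * (norm w')\<^sup>2 / 2 + (norm c')\<^sup>2 / 2)"
    by simp
  have "\<bar>(r * w $ i + r' * w' $ i) * (((norm c)\<^sup>2 - (norm c')\<^sup>2) / 2)\<bar>
      = x * \<bar>(norm c)\<^sup>2 - (norm c')\<^sup>2\<bar> / 2"
    by (simp add: abs_mult x_def)
  also have "\<dots> \<le> norm (c - c') * (x * y / 2)"
    using mult_left_mono[OF cc, of x] by (simp add: x_def algebra_simps)
  also have "\<dots> \<le> norm (c - c') *
      (r\<^sup>2 * (norm w)\<^sup>2 / 2 + (norm c)\<^sup>2 / 2 + (r'\<^sup>2 * (norm w')\<^sup>2 / 2 + (norm c')\<^sup>2 / 2))"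
    by (rule mult_left_mono[OF xy]) simp
  finally show ?thesis .
qed

text \<open>One bound for each of the quantities \<open>K\<close>, \<open>K'\<close>,
  \<open>m\<close>, \<open>m'\<close> in \<open>flux_difference_bound\<close>: kinetic plus internal
  energy moves with the own speed, magnetic energy with the averaged one.\<close>

lemma wave_speed_bounds:
  fixes p i U V
  defines "\<delta> \<equiv> norm (magnetic U - magnetic V) / (sqrt (density U) + sqrt (density V))"
    and "A \<equiv> \<bar>sqrt (density U) * velocity U $ i + sqrt (density V) * velocity V $ i\<bar>
              / (sqrt (density U) + sqrt (density V))"
  shows "\<bar>velocity U $ i\<bar> + fast_speed p i U + \<delta> \<le> wave_speed p i U V"
    "\<bar>velocity V $ i\<bar> + fast_speed p i V + \<delta> \<le> wave_speed p i U V"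
    "A + fast_speed p i U + \<delta> \<le> wave_speed p i U V"
    "A + fast_speed p i V + \<delta> \<le> wave_speed p i U V"
  by (auto simp: wave_speed_def Let_def A_def \<delta>_def max_def)

lemma wave_speed_nonneg:
  assumes "density U > 0" "density V > 0" shows "wave_speed p i U V \<ge> 0"
proof -
  have "0 \<le> norm (magnetic U - magnetic V) / (sqrt (density U) + sqrt (density V))"
    using assms by simp
  then show ?thesis
    using wave_speed_bounds(1)[where U = U and V = V and p = p and i = i] fast_speed_nonneg[of U p i] assms
    by linarith
qed

text \<open>The test velocity \<open>v\<close> is unbounded and enters through \<open>v\<^sub>i (\<bar>c\<bar>\<^sup>2 - \<bar>c'\<bar>\<^sup>2)/2\<close>. Writing \<open>v\<^sub>i\<close> as
  the \<open>\<surd>\<rho>\<close>-weighted average of the two velocities minus that of \<open>w\<close> and \<open>w'\<close> produces the averaged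
  speed and the jump term \<open>\<bar>B - B'\<bar> / (\<surd>\<rho> + \<surd>\<rho>')\<close> of the wave speed.\<close>

lemma flux_difference_bound:
  fixes v b :: "real^3"
  assumes "eos p" and U: "U \<in> admissible" and V: "V \<in> admissible"
    and Bi: "magnetic U $ i = magnetic V $ i"
  shows "\<bar>support_form v b (flux p i U) - support_form v b (flux p i V)\<bar>
    \<le> wave_speed p i U V *
       ((support_form v b U + (norm b)\<^sup>2 / 2) + (support_form v b V + (norm b)\<^sup>2 / 2))"
proof -
  have \<rho>: "density U > 0" "density V > 0" and ie: "internal_energy U > 0" "internal_energy V > 0"
    using U V by (auto simp: admissible_def)
  define r r' w w' c c' where "r = sqrt (density U)" and "r' = sqrt (density V)"
    and "w = velocity U - v" and "w' = velocity V - v"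
    and "c = magnetic U - b" and "c' = magnetic V - b"
  define \<delta> A where "\<delta> = norm (c - c') / (r + r')"
    and "A = (r * velocity U $ i + r' * velocity V $ i) / (r + r')"
  have r: "r > 0" "r' > 0" "r + r' > 0" and r2: "r\<^sup>2 = density U" "r'\<^sup>2 = density V"
    using \<rho> by (auto simp: r_def r'_def add_pos_pos)
  define K K' m m' where "K = density U * (norm w)\<^sup>2 / 2 + internal_energy U"
    and "K' = density V * (norm w')\<^sup>2 / 2 + internal_energy V"
    and "m = (norm c)\<^sup>2 / 2" and "m' = (norm c')\<^sup>2 / 2"
  have nn: "K \<ge> 0" "K' \<ge> 0" "m \<ge> 0" "m' \<ge> 0" "\<delta> \<ge> 0"
    using \<rho> ie r by (auto simp: K_def K'_def m_def m'_def \<delta>_def)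
  define N N' where "N = pressure p U * w $ i + (w $ i *\<^sub>R magnetic U - magnetic U $ i *\<^sub>R w) \<bullet> c"
    and "N' = pressure p V * w' $ i + (w' $ i *\<^sub>R magnetic V - magnetic V $ i *\<^sub>R w') \<bullet> c'"
  have N: "\<bar>N\<bar> \<le> fast_speed p i U * (K + m)" "\<bar>N'\<bar> \<le> fast_speed p i V * (K' + m')"
    using fast_speed_bound[OF \<open>eos p\<close> U, of w i c] fast_speed_bound[OF \<open>eos p\<close> V, of w' i c']
    by (simp_all add: N_def N'_def K_def K'_def m_def m'_def add_ac)
  \<comment> \<open>The terms without \<open>w\<close> and \<open>c\<close> cancel here, by
    \<open>Bi\<close>.\<close>
  have F: "support_form v b (flux p i U) - support_form v b (flux p i V)
      = velocity U $ i * K - velocity V $ i * K' + (N - N') + v $ i * (m - m')"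
    unfolding flux_support_form[OF \<rho>(1)] flux_support_form[OF \<rho>(2)]
    by (simp add: K_def K'_def N_def N'_def m_def m'_def w_def w'_def c_def c'_def Bi algebra_simps)
  have "(r + r') * v $ i = (r * velocity U $ i + r' * velocity V $ i) - (r * w $ i + r' * w' $ i)"
    by (simp add: w_def w'_def algebra_simps)
  then have "(r + r') * v $ i / (r + r') = A - (r * w $ i + r' * w' $ i) / (r + r')"
    by (simp add: A_def diff_divide_distrib)
  then have vi: "v $ i = A - (r * w $ i + r' * w' $ i) / (r + r')"
    using r by simp
  have "\<bar>(r * w $ i + r' * w' $ i) / (r + r') * (m - m')\<bar>
      = \<bar>(r * w $ i + r' * w' $ i) * (((norm c)\<^sup>2 - (norm c')\<^sup>2) / 2)\<bar> / (r + r')"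
    using r by (simp add: m_def m'_def abs_mult diff_divide_distrib)
  also have "\<dots> \<le> norm (c - c') * (r\<^sup>2 * (norm w)\<^sup>2 / 2 + (norm c)\<^sup>2 / 2
      + (r'\<^sup>2 * (norm w')\<^sup>2 / 2 + (norm c')\<^sup>2 / 2)) / (r + r')"
    using r by (intro divide_right_mono cross_term_bound) auto
  also have "\<dots> = \<delta> * (r\<^sup>2 * (norm w)\<^sup>2 / 2 + (norm c)\<^sup>2 / 2
      + (r'\<^sup>2 * (norm w')\<^sup>2 / 2 + (norm c')\<^sup>2 / 2))"
    by (simp add: \<delta>_def)
  also have "\<dots> \<le> \<delta> * (K + m + (K' + m'))"
    using ie nn by (intro mult_left_mono) (auto simp: r2 K_def K'_def m_def m'_def)
  finally have cross: "\<bar>(r * w $ i + r' * w' $ i) / (r + r') * (m - m')\<bar> \<le> \<delta> * (K + m + (K' + m'))" .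
  have tri: "\<bar>x - y\<bar> \<le> s + t" if "\<bar>x\<bar> \<le> s" "\<bar>y\<bar> \<le> t" for x y s t :: real
    using that by linarith
  have "\<bar>A * (m - m')\<bar> \<le> \<bar>A\<bar> * (m + m')"
    using nn unfolding abs_mult by (intro mult_left_mono) auto
  note tri[OF this cross]
  moreover have "v $ i * (m - m') = A * (m - m') - (r * w $ i + r' * w' $ i) / (r + r') * (m - m')"
    by (simp add: vi left_diff_distrib)
  ultimately have vm: "\<bar>v $ i * (m - m')\<bar> \<le> \<bar>A\<bar> * (m + m') + \<delta> * (K + m + (K' + m'))"
    by simp
  have vK: "\<bar>velocity U $ i * K\<bar> = \<bar>velocity U $ i\<bar> * K" "\<bar>velocity V $ i * K'\<bar> = \<bar>velocity V $ i\<bar> * K'"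
    using nn by (simp_all add: abs_mult)
  let ?s = "wave_speed p i U V"
  have "c - c' = magnetic U - magnetic V" by (simp add: c_def c'_def)
  then have "\<delta> = norm (magnetic U - magnetic V) / (sqrt (density U) + sqrt (density V))"
    by (simp add: \<delta>_def r_def r'_def)
  moreover have "\<bar>A\<bar> = \<bar>sqrt (density U) * velocity U $ i + sqrt (density V) * velocity V $ i\<bar>
              / (sqrt (density U) + sqrt (density V))"
    using r by (simp add: A_def r_def r'_def)
  ultimately have s: "\<bar>velocity U $ i\<bar> + fast_speed p i U + \<delta> \<le> ?s"
    "\<bar>velocity V $ i\<bar> + fast_speed p i V + \<delta> \<le> ?s"
    "\<bar>A\<bar> + fast_speed p i U + \<delta> \<le> ?s" "\<bar>A\<bar> + fast_speed p i V + \<delta> \<le> ?s"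
    using wave_speed_bounds[where U = U and V = V and p = p and i = i] by simp_all
  have "\<bar>support_form v b (flux p i U) - support_form v b (flux p i V)\<bar>
      \<le> \<bar>velocity U $ i\<bar> * K + \<bar>velocity V $ i\<bar> * K'
        + (fast_speed p i U * (K + m) + fast_speed p i V * (K' + m'))
        + (\<bar>A\<bar> * (m + m') + \<delta> * (K + m + (K' + m')))"
    unfolding F using vK N vm by linarith
  also have "\<dots> = (\<bar>velocity U $ i\<bar> + fast_speed p i U + \<delta>) * K + (\<bar>velocity V $ i\<bar> + fast_speed p i V + \<delta>) * K'
      + (\<bar>A\<bar> + fast_speed p i U + \<delta>) * m + (\<bar>A\<bar> + fast_speed p i V + \<delta>) * m'"
    by (simp add: algebra_simps)
  also have "\<dots> \<le> ?s * K + ?s * K' + ?s * m + ?s * m'"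
    using nn s by (intro add_mono mult_right_mono) auto
  also have "\<dots> = ?s * ((support_form v b U + (norm b)\<^sup>2 / 2) + (support_form v b V + (norm b)\<^sup>2 / 2))"
    unfolding support_form_eq[OF \<rho>(1)] support_form_eq[OF \<rho>(2)]
    by (simp add: K_def K'_def m_def m'_def w_def w'_def c_def c'_def algebra_simps)
  finally show ?thesis .
qed

lemma density_flux: "density U > 0 \<Longrightarrow> density (flux p i U) = density U * velocity U $ i"
  by (simp add: flux_def Let_def density_def)

lemma Lax_Friedrichs_splitting_admissible:
  assumes "eos p" and U: "U \<in> admissible" and V: "V \<in> admissible"
    and Bi: "magnetic U $ i = magnetic V $ i" and a: "wave_speed p i U V < a"
  shows "(1 / 2) *\<^sub>R (U + V - (1 / a) *\<^sub>R (flux p i U - flux p i V)) \<in> admissible" (is "?W \<in> _")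
proof -
  have \<rho>: "density U > 0" "density V > 0" using U V by (auto simp: admissible_def)
  have "0 \<le> norm (magnetic U - magnetic V) / (sqrt (density U) + sqrt (density V))"
    using \<rho> by simp
  then have v: "\<bar>velocity U $ i\<bar> < a" "\<bar>velocity V $ i\<bar> < a"
    using wave_speed_bounds(1,2)[where U = U and V = V and p = p and i = i] fast_speed_nonneg[OF \<rho>(1), of p i]
      fast_speed_nonneg[OF \<rho>(2), of p i] a by linarith+
  then have "a > 0" by linarith
  \<comment> \<open>These are the weights of the two densities in the splitting, since the density
    flux is density times normal velocity.\<close>
  have "a - velocity U $ i > 0" "a + velocity V $ i > 0" using v by linarith+
  then have "density U * (a - velocity U $ i) + density V * (a + velocity V $ i) > 0"
    using \<rho> by (simp add: add_pos_pos)
  moreover have "density ?W = (density U * (a - velocity U $ i) + density V * (a + velocity V $ i)) / (2 * a)"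
    using \<open>a > 0\<close> \<rho> by (simp add: density_flux field_simps)
  ultimately have "density ?W > 0" using \<open>a > 0\<close> by simp
  moreover have "support_form v b ?W + (norm b)\<^sup>2 / 2 > 0" for v b
  proof -
    define Q where "Q = (support_form v b U + (norm b)\<^sup>2 / 2) + (support_form v b V + (norm b)\<^sup>2 / 2)"
    have "Q > 0" unfolding Q_def using U V by (intro add_pos_pos support_form_pos)
    have "support_form v b (flux p i U) - support_form v b (flux p i V) \<le> wave_speed p i U V * Q"
      using flux_difference_bound[OF \<open>eos p\<close> U V Bi, of v b] by (simp add: Q_def)
    also have "\<dots> < a * Q" using a \<open>Q > 0\<close> by simp
    finally have "(support_form v b (flux p i U) - support_form v b (flux p i V)) / a < Q"
      using \<open>a > 0\<close> by (simp add: field_simps)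
    \<comment> \<open>The factor 1/2 in \<open>?W\<close> reduces the two copies of |b|^2/2 inside
      \<open>Q\<close> to the single one required.\<close>
    moreover have "support_form v b ?W + (norm b)\<^sup>2 / 2
        = (Q - (support_form v b (flux p i U) - support_form v b (flux p i V)) / a) / 2"
      by (simp add: Q_def support_form_add support_form_diff support_form_scaleR
          add_divide_distrib diff_divide_distrib)
    ultimately show ?thesis by simp
  qed
  ultimately show ?thesis by (simp add: admissible_iff_support_form)
qed


section \<open>The Gauss--Lobatto rule\<close>

lemma integrable_poly [simp]: "poly p integrable_on {a..b :: real}"
  by (intro integrable_continuous_real continuous_intros)

lemma integral_poly_pderiv:
  assumes "a \<le> (b :: real)"
  shows "integral {a..b} (poly (pderiv p)) = poly p b - poly p a"
  by (rule integral_unique[OF fundamental_theorem_of_calculus])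
    (auto simp: assms has_real_derivative_iff_has_vector_derivative[symmetric]
      intro: DERIV_subset[OF poly_DERIV])

lemma integral_poly_add:
  "integral {a..b :: real} (poly (p + q)) = integral {a..b} (poly p) + integral {a..b} (poly q)"
  using integral_add[OF integrable_poly[of p a b] integrable_poly[of q a b]] by (simp add: poly_add[abs_def])

lemma integral_poly_diff:
  "integral {a..b :: real} (poly (p - q)) = integral {a..b} (poly p) - integral {a..b} (poly q)"
  using integral_diff[OF integrable_poly[of p a b] integrable_poly[of q a b]] by (simp add: poly_diff[abs_def])

lemma integral_poly_smult:
  "integral {a..b :: real} (poly (smult c p)) = c * integral {a..b} (poly p)"
  by (simp add: poly_smult[abs_def])

lemma integral_poly_sum:
  "integral {a..b :: real} (poly (\<Sum>x\<in>A. p x)) = (\<Sum>x\<in>A. integral {a..b} (poly (p x)))"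
proof (induction A rule: infinite_finite_induct)
  case (insert x F)
  then show ?case by (simp add: integral_poly_add del: poly_add)
qed (simp_all add: poly_0[abs_def])

section \<open>Zeros, parity and orthogonality of the derivatives of (x^2 - 1)^n\<close>

lemma power_dvd_pderiv:
  fixes a :: "'a :: idom poly"
  assumes "a ^ Suc k dvd p" shows "a ^ k dvd pderiv p"
proof -
  from assms obtain r where "p = a ^ Suc k * r" by (elim dvdE)
  then have "pderiv p = a ^ k * (a * pderiv r + smult (of_nat (Suc k)) (r * pderiv a))"
    unfolding \<open>p = _\<close> pderiv_mult pderiv_power_Suc by (simp add: algebra_simps del: of_nat_Suc)
  then show ?thesis by simp
qed

lemma power_dvd_higher_pderiv_power:
  fixes a :: "'a :: idom poly"
  shows "j \<le> n \<Longrightarrow> a ^ (n - j) dvd (pderiv ^^ j) (a ^ n)"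
proof (induction j)
  case (Suc j)
  then have "a ^ Suc (n - Suc j) dvd (pderiv ^^ j) (a ^ n)" by (simp add: Suc_diff_Suc del: power_Suc)
  then show ?case using power_dvd_pderiv by simp
qed simp

text \<open>By the chain rule each derivative of an even polynomial contributes one sign. This is
  the source of the symmetry of nodes and weights.\<close>

lemma higher_pderiv_reflect:
  fixes p :: "'a :: idom poly"
  assumes "pcompose p [:0, -1:] = p"
  shows "pcompose ((pderiv ^^ m) p) [:0, -1:] = smult ((-1) ^ m) ((pderiv ^^ m) p)"
proof (induction m)
  case (Suc m)
  let ?q = "(pderiv ^^ m) p"
  have "pderiv (pcompose ?q [:0, -1:]) = - pcompose (pderiv ?q) [:0, -1:]"
    by (simp add: pderiv_pcompose pderiv_pCons)
  then have "pcompose (pderiv ?q) [:0, -1:] = - pderiv (smult ((-1) ^ m) ?q)"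
    by (simp add: Suc)
  then show ?case by (simp add: pderiv_smult)
qed (simp add: assms)

text \<open>Induction removing the largest zero: the mean value theorem between the two largest
  zeros gives a new one to the right of all those found before.\<close>

lemma Rolle_roots:
  fixes p :: "real poly"
  assumes "finite Z" "card Z = Suc c" "\<forall>z\<in>Z. poly p z = 0"
  shows "\<exists>S. S \<subseteq> {Min Z<..<Max Z} \<and> finite S \<and> card S = c \<and> (\<forall>z\<in>S. poly (pderiv p) z = 0)"
  using assms
proof (induction c arbitrary: Z)
  case 0
  show ?case by (rule exI[of _ "{}"]) simp
next
  case (Suc c)
  define M Z' where "M = Max Z" and "Z' = Z - {M}"
  have "Z \<noteq> {}" using Suc.prems by auto
  then have M: "M \<in> Z" using Suc.prems by (simp add: M_def)
  then have Z': "finite Z'" "card Z' = Suc c" "\<forall>z\<in>Z'. poly p z = 0"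
    using Suc.prems by (auto simp: Z'_def)
  then have "Z' \<noteq> {}" by auto
  then have M': "Max Z' \<in> Z'" using Z' by simp
  then have "Max Z' < M"
    using Suc.prems by (auto simp: Z'_def M_def intro: le_neq_trans)
  from poly_MVT[OF this, of p] obtain x where
    x: "Max Z' < x" "x < M" "poly p M - poly p (Max Z') = (M - Max Z') * poly (pderiv p) x" by blast
  then have x0: "poly (pderiv p) x = 0"
    using M M' Z' Suc.prems \<open>Max Z' < M\<close> by auto
  from Suc.IH[OF Z'] obtain S where S: "S \<subseteq> {Min Z'<..<Max Z'}" "finite S" "card S = c"
    "\<forall>z\<in>S. poly (pderiv p) z = 0" by blast
  have "Min Z \<le> Min Z'"
    using \<open>Z' \<noteq> {}\<close> Suc.prems by (intro Min_antimono) (auto simp: Z'_def)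
  moreover have "Min Z' \<le> Max Z'" using Z' \<open>Z' \<noteq> {}\<close> by simp
  ultimately have "x \<in> {Min Z<..<M}" "S \<subseteq> {Min Z<..<M}" "x \<notin> S"
    using S(1) x(1,2) by auto
  then show ?case
    using S(2-4) x0 unfolding M_def by (intro exI[of _ "insert x S"]) simp
qed

text \<open>For m = n this is the Legendre polynomial up to normalization, for m = n + 1 its
  derivative. A free order \<open>m\<close> lets Rolle and integration by parts run by
  induction.\<close>

definition rodrigues :: "nat \<Rightarrow> nat \<Rightarrow> real poly" where
  "rodrigues n m = (pderiv ^^ m) ([:-1, 0, 1:] ^ n)"

lemma rodrigues_Suc: "rodrigues n (Suc m) = pderiv (rodrigues n m)"
  by (simp add: rodrigues_def)

lemma degree_rodrigues: "degree (rodrigues n m) = 2 * n - m"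
  by (simp add: rodrigues_def degree_higher_pderiv degree_power_eq)

lemma rodrigues_nonzero: "m \<le> 2 * n \<Longrightarrow> rodrigues n m \<noteq> 0"
proof (induction m)
  case (Suc m)
  then show ?case by (simp add: rodrigues_Suc pderiv_eq_0_iff degree_rodrigues)
qed (simp add: rodrigues_def)

text \<open>Each derivative costs at most one factor x^2 - 1 of the n given ones.\<close>

lemma rodrigues_end_points:
  assumes "m < n" "x\<^sup>2 = 1" shows "poly (rodrigues n m) x = 0"
proof -
  have "[:-1, 0, 1:] ^ (n - m) dvd rodrigues n m"
    using power_dvd_higher_pderiv_power[of m n "[:-1, 0, 1 :: real:]"] assms by (simp add: rodrigues_def)
  then obtain r where "rodrigues n m = [:-1, 0, 1:] ^ (n - m) * r" by (elim dvdE)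
  then show ?thesis using assms by (simp add: poly_power power2_eq_square)
qed

lemma rodrigues_minus: "poly (rodrigues n m) (- x) = (-1) ^ m * poly (rodrigues n m) x"
proof -
  have "pcompose ([:-1, 0, 1 :: real:] ^ n) [:0, -1:] = [:-1, 0, 1:] ^ n"
    by (intro poly_eq_poly_eq_iff[THEN iffD1] ext) (simp add: poly_pcompose poly_power)
  from higher_pderiv_reflect[OF this, of m]
  have "poly (pcompose (rodrigues n m) [:0, -1:]) x = poly (smult ((-1) ^ m) (rodrigues n m)) x"
    by (simp add: rodrigues_def)
  then show ?thesis by (simp add: poly_pcompose)
qed

text \<open>While m < n the points -1 and 1 are zeros too, so every application of Rolle gains one
  interior zero.\<close>

lemma rodrigues_roots:
  "m \<le> n \<Longrightarrow> \<exists>S \<subseteq> {-1<..<1}. finite S \<and> card S = m \<and> (\<forall>z\<in>S. poly (rodrigues n m) z = 0)"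
proof (induction m)
  case 0
  show ?case by (rule exI[of _ "{}"]) simp
next
  case (Suc m)
  then obtain S where S: "S \<subseteq> {-1<..<1}" "finite S" "card S = m" "\<forall>z\<in>S. poly (rodrigues n m) z = 0"
    by auto
  define Z where "Z = insert (-1) (insert 1 S)"
  have Z: "finite Z" "card Z = Suc (Suc m)" using S by (auto simp: Z_def card_insert_if)
  have "\<forall>z\<in>Z. poly (rodrigues n m) z = 0"
    using S Suc.prems by (auto simp: Z_def rodrigues_end_points)
  from Rolle_roots[OF Z this] obtain S' where
    S': "S' \<subseteq> {Min Z<..<Max Z}" "finite S'" "card S' = Suc m" "\<forall>z\<in>S'. poly (pderiv (rodrigues n m)) z = 0"
    by blast
  have "-1 \<le> Min Z" "Max Z \<le> 1"
    using S by (auto simp: Z_def)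
  then have "S' \<subseteq> {-1<..<1}" using S' by fastforce
  then show ?case using S' by (auto simp: rodrigues_Suc)
qed

text \<open>Integration by parts: the boundary terms vanish and the derivative passes to
  \<open>q\<close>. The alternative \<open>q = 0\<close> is needed because the derivative of a
  constant still has degree 0.\<close>

lemma rodrigues_orthogonal:
  "j \<le> n \<Longrightarrow> degree q < j \<or> q = 0 \<Longrightarrow> integral {-1..1} (poly (rodrigues n j * q)) = 0"
proof (induction j arbitrary: q)
  case (Suc j)
  have "rodrigues n (Suc j) * q = pderiv (rodrigues n j * q) - rodrigues n j * pderiv q"
    by (simp add: pderiv_mult rodrigues_Suc)
  moreover have "degree (pderiv q) < j \<or> pderiv q = 0"
    using Suc.prems by (auto simp: degree_pderiv pderiv_eq_0_iff)
  ultimately show ?case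
    using Suc by (simp add: integral_poly_diff integral_poly_pderiv rodrigues_end_points
        del: poly_diff poly_mult) (simp add: rodrigues_end_points)
qed (simp add: poly_0[abs_def])

section \<open>Nodes, exactness and weights of the rule\<close>

definition interior_nodes :: "nat \<Rightarrow> real set" where
  "interior_nodes n = {x. poly (rodrigues n (Suc n)) x = 0}"

lemma lobatto_nodes_Suc: "lobatto_nodes (Suc n) = {-1, 1} \<union> interior_nodes n"
  by (simp add: lobatto_nodes_def interior_nodes_def legendre_poly_def pderiv_smult
      rodrigues_Suc rodrigues_def)

text \<open>Rolle produces n - 1 zeros inside (-1, 1), and the degree 2n - (n + 1) leaves room for
  no others.\<close>

lemma interior_nodes:
  assumes "n \<ge> 1"
  shows "finite (interior_nodes n)" "card (interior_nodes n) = n - 1" "interior_nodes n \<subseteq> {-1<..<1}"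
proof -
  have nz: "rodrigues n (Suc n) \<noteq> 0" using assms by (intro rodrigues_nonzero) simp
  then show fin: "finite (interior_nodes n)"
    unfolding interior_nodes_def by (rule poly_roots_finite)
  obtain Z where Z: "Z \<subseteq> {-1<..<1}" "finite Z" "card Z = Suc (n - 1)" "\<forall>z\<in>Z. poly (rodrigues n n) z = 0"
    using rodrigues_roots[of n n] assms by auto
  from Rolle_roots[OF Z(2-4)] obtain S where
    S: "S \<subseteq> {Min Z<..<Max Z}" "finite S" "card S = n - 1" "\<forall>z\<in>S. poly (rodrigues n (Suc n)) z = 0"
    unfolding rodrigues_Suc by blast
  have "Z \<noteq> {}" using Z(3) by auto
  then have "Min Z \<in> Z" "Max Z \<in> Z" using Z(2) by simp_all
  then have "S \<subseteq> {-1<..<1}" using Z(1) S(1) by fastforce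
  have sub: "S \<subseteq> interior_nodes n" using S by (auto simp: interior_nodes_def)
  have "card (interior_nodes n) \<le> degree (rodrigues n (Suc n))"
    unfolding interior_nodes_def by (rule card_poly_roots_bound[OF nz])
  also have "\<dots> = card S" by (simp add: degree_rodrigues S)
  finally have "S = interior_nodes n" using sub fin by (simp add: card_seteq)
  then show "card (interior_nodes n) = n - 1" "interior_nodes n \<subseteq> {-1<..<1}"
    using S \<open>S \<subseteq> {-1<..<1}\<close> by auto
qed

lemma lobatto_nodes_props:
  assumes "n \<ge> 1"
  shows "finite (lobatto_nodes (Suc n))" "card (lobatto_nodes (Suc n)) = Suc n"
    "lobatto_nodes (Suc n) \<subseteq> {-1..1}"
proof -
  note I = interior_nodes[OF assms]
  have "-1 \<notin> interior_nodes n" "1 \<notin> interior_nodes n" using I by auto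
  then show "finite (lobatto_nodes (Suc n))" "card (lobatto_nodes (Suc n)) = Suc n"
    "lobatto_nodes (Suc n) \<subseteq> {-1..1}"
    using I assms by (auto simp: lobatto_nodes_Suc)
qed

definition lagrange_basis :: "real set \<Rightarrow> real \<Rightarrow> real poly" where
  "lagrange_basis X \<xi> = (\<Prod>\<eta>\<in>X - {\<xi>}. smult (1 / (\<xi> - \<eta>)) [:-\<eta>, 1:])"

lemma poly_lagrange_basis: "poly (lagrange_basis X \<xi>) t = (\<Prod>\<eta>\<in>X - {\<xi>}. (t - \<eta>) / (\<xi> - \<eta>))"
  by (simp add: lagrange_basis_def poly_prod diff_divide_distrib)

lemma lagrange_interpolation:
  assumes "finite X" "degree p < card X"
  shows "p = (\<Sum>\<xi>\<in>X. smult (poly p \<xi>) (lagrange_basis X \<xi>))" (is "p = ?q")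
proof (rule poly_eqI_degree[of X])
  have delta: "poly (lagrange_basis X \<xi>) x = (if \<xi> = x then 1 else 0)" if "x \<in> X" for x \<xi>
    using that assms(1) by (auto simp: poly_lagrange_basis intro!: prod.neutral prod_zero)
  show "poly p x = poly ?q x" if "x \<in> X" for x
    using that assms(1) by (simp add: poly_sum delta sum.delta if_distrib cong: if_cong)
  show "card X > degree p" by fact
  have "degree (lagrange_basis X \<xi>) \<le> card X - 1" if "\<xi> \<in> X" for \<xi>
  proof -
    have "degree (lagrange_basis X \<xi>) \<le> sum (degree \<circ> (\<lambda>\<eta>. smult (1 / (\<xi> - \<eta>)) [:-\<eta>, 1:])) (X - {\<xi>})"
      unfolding lagrange_basis_def using assms(1) by (intro degree_prod_sum_le) simp
    also have "\<dots> \<le> (\<Sum>\<eta>\<in>X - {\<xi>}. 1)" by (intro sum_mono) simp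
    also have "\<dots> = card X - 1" using that assms(1) by simp
    finally show ?thesis .
  qed
  then have "degree ?q \<le> card X - 1"
    using assms(1) by (intro degree_sum_le order.trans[OF degree_smult_le]) auto
  then show "card X > degree ?q" using assms(2) by linarith
qed

lemma lobatto_weight_eq:
  "lobatto_weight L \<xi> = 1 / 2 * integral {-1..1} (poly (lagrange_basis (lobatto_nodes L) \<xi>))"
  unfolding lobatto_weight_def poly_lagrange_basis[abs_def] ..

text \<open>Division by the nodal polynomial \<open>\<omega>\<close>: the remainder has degree at
  most n and is reproduced by interpolation, while the multiple of \<open>\<omega>\<close> vanishes
  at the nodes and integrates to 0 by parts and orthogonality.\<close>

lemma lobatto_exact:
  assumes "n \<ge> 1" "degree p \<le> 2 * n - 1"
  shows "1 / 2 * integral {-1..1} (poly p)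
       = (\<Sum>\<xi>\<in>lobatto_nodes (Suc n). lobatto_weight (Suc n) \<xi> * poly p \<xi>)"
proof -
  define \<omega> d r where "\<omega> = rodrigues n (Suc n) * [:-1, 0, 1:]" and "d = p div \<omega>" and "r = p mod \<omega>"
  have nz: "rodrigues n (Suc n) \<noteq> 0" using assms by (intro rodrigues_nonzero) simp
  have deg: "degree \<omega> = Suc n"
    unfolding \<omega>_def by (subst degree_mult_eq[OF nz]) (use assms in \<open>auto simp: degree_rodrigues\<close>)
  then have "\<omega> \<noteq> 0" by auto
  then have degr: "degree r < Suc n"
    using degree_mod_less[of \<omega> p] deg by (auto simp: r_def)
  have p: "p = \<omega> * d + r" by (simp add: d_def r_def)
  have "integral {-1..1} (poly (\<omega> * d)) = 0"
  proof (cases "d = 0")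
    case True
    then show ?thesis by (simp add: poly_0[abs_def])
  next
    case False
    then have "degree (\<omega> * d) = Suc n + degree d" using \<open>\<omega> \<noteq> 0\<close> deg by (simp add: degree_mult_eq)
    then have "degree p = Suc n + degree d" unfolding p using degr by (subst degree_add_eq_left) auto
    \<comment> \<open>The bound 2n - 1 enters here: it is what makes the degree of
      \<open>pderiv u\<close> less than n.\<close>
    then have d: "degree d + 2 \<le> n" using assms by simp
    define u where "u = [:-1, 0, 1:] * d"
    have "degree u \<le> n" unfolding u_def using d degree_mult_le[of "[:-1, 0, 1:]" d] by simp
    then have "degree (pderiv u) < n" using assms by (simp add: degree_pderiv)
    then have "integral {-1..1} (poly (rodrigues n n * pderiv u)) = 0"
      by (intro rodrigues_orthogonal) auto
    moreover have "\<omega> * d = pderiv (rodrigues n n * u) - rodrigues n n * pderiv u"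
      by (simp add: \<omega>_def u_def pderiv_mult rodrigues_Suc algebra_simps
          del: mult_pCons_left mult_pCons_right)
    moreover have "poly u 1 = 0" "poly u (-1) = 0" by (simp_all add: u_def)
    ultimately show ?thesis
      by (simp add: integral_poly_diff integral_poly_pderiv del: poly_diff poly_mult) simp
  qed
  then have "integral {-1..1} (poly p) = integral {-1..1} (poly r)"
    by (subst p) (simp add: integral_poly_add)
  also have "r = (\<Sum>\<xi>\<in>lobatto_nodes (Suc n). smult (poly r \<xi>) (lagrange_basis (lobatto_nodes (Suc n)) \<xi>))"
    using lobatto_nodes_props[OF assms(1)] degr by (intro lagrange_interpolation) auto
  finally have "1 / 2 * integral {-1..1} (poly p)
      = (\<Sum>\<xi>\<in>lobatto_nodes (Suc n). lobatto_weight (Suc n) \<xi> * poly r \<xi>)"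
    by (simp add: integral_poly_sum integral_poly_smult lobatto_weight_eq sum_distrib_left mult_ac)
  also have "\<dots> = (\<Sum>\<xi>\<in>lobatto_nodes (Suc n). lobatto_weight (Suc n) \<xi> * poly p \<xi>)"
  proof (rule sum.cong)
    fix \<xi> assume "\<xi> \<in> lobatto_nodes (Suc n)"
    then have "poly \<omega> \<xi> = 0" by (auto simp: lobatto_nodes_Suc interior_nodes_def \<omega>_def)
    then show "lobatto_weight (Suc n) \<xi> * poly r \<xi> = lobatto_weight (Suc n) \<xi> * poly p \<xi>"
      by (subst p) simp
  qed simp
  finally show ?thesis .
qed

lemma lobatto_weight_sum:
  "n \<ge> 1 \<Longrightarrow> (\<Sum>\<xi>\<in>lobatto_nodes (Suc n). lobatto_weight (Suc n) \<xi>) = 1"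
  using lobatto_exact[of n 1] by (simp add: poly_1[abs_def])

text \<open>Apply exactness to a polynomial that is nonnegative on [-1, 1], positive at
  \<open>\<xi>\<close> and zero at all other nodes; only the term of \<open>\<xi>\<close>
  survives.\<close>

lemma lobatto_weight_nonneg:
  assumes n: "n \<ge> 1" and \<xi>: "\<xi> \<in> lobatto_nodes (Suc n)"
  shows "lobatto_weight (Suc n) \<xi> \<ge> 0"
proof -
  note I = interior_nodes[OF n]
  have *: ?thesis if deg: "degree f \<le> 2 * n - 1" and f: "\<And>t. t \<in> {-1..1} \<Longrightarrow> poly f t \<ge> 0"
    and pos: "poly f \<xi> > 0" and z: "\<And>\<eta>. \<eta> \<in> lobatto_nodes (Suc n) \<Longrightarrow> \<eta> \<noteq> \<xi> \<Longrightarrow> poly f \<eta> = 0" for f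
  proof -
    have "0 \<le> 1 / 2 * integral {-1..1} (poly f)" using integral_nonneg[OF integrable_poly f] by simp
    also have "\<dots> = (\<Sum>\<eta>\<in>lobatto_nodes (Suc n). lobatto_weight (Suc n) \<eta> * poly f \<eta>)"
      using n deg by (rule lobatto_exact)
    also have "\<dots> = (\<Sum>\<eta>\<in>{\<xi>}. lobatto_weight (Suc n) \<eta> * poly f \<eta>)"
      using \<xi> z lobatto_nodes_props[OF n] by (intro sum.mono_neutral_right) auto
    finally show ?thesis using pos by (simp add: zero_le_mult_iff)
  qed
  define g where "g A = (\<Prod>\<eta>\<in>A. [:-\<eta>, 1:])" for A :: "real set"
  have deg_g: "degree (g A) = card A" for A
    unfolding g_def by (subst degree_prod_eq_sum_degree) auto
  have g0: "poly (g A) t = 0 \<longleftrightarrow> t \<in> A" if "finite A" for A t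
    using that by (auto simp: g_def poly_prod)
  show ?thesis
  proof (cases "\<xi> \<in> interior_nodes n")
    case True
    let ?A = "interior_nodes n - {\<xi>}"
    have "card (interior_nodes n) > 0" using True I(1) by (auto simp: card_gt_0_iff)
    then have "n \<ge> 2" using I(2) by simp
    have "\<bar>\<xi>\<bar> < 1" using True I(3) by force
    then have "\<xi>\<^sup>2 < 1" by (simp add: abs_square_less_1)
    have "degree ([:1, 0, -1:] * (g ?A)\<^sup>2) \<le> 2 + degree ((g ?A)\<^sup>2)"
      by (rule order.trans[OF degree_mult_le]) simp
    also have "degree ((g ?A)\<^sup>2) \<le> 2 * (n - 2)"
      by (rule order.trans[OF degree_power_le]) (use True I in \<open>simp add: deg_g\<close>)
    finally have deg: "degree ([:1, 0, -1:] * (g ?A)\<^sup>2) \<le> 2 * n - 1" using \<open>n \<ge> 2\<close> by simp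
    have val: "poly ([:1, 0, -1:] * (g ?A)\<^sup>2) t = (1 - t\<^sup>2) * (poly (g ?A) t)\<^sup>2" for t
      by (simp add: power2_eq_square algebra_simps)
    show ?thesis
    proof (rule *[OF deg]; unfold val)
      show "0 \<le> (1 - t\<^sup>2) * (poly (g ?A) t)\<^sup>2" if "t \<in> {-1..1}" for t
        using that by (intro mult_nonneg_nonneg) (auto simp: abs_square_le_1 abs_le_iff)
      show "0 < (1 - \<xi>\<^sup>2) * (poly (g ?A) \<xi>)\<^sup>2"
        using \<open>\<xi>\<^sup>2 < 1\<close> I(1) by (simp add: g0)
      show "(1 - \<eta>\<^sup>2) * (poly (g ?A) \<eta>)\<^sup>2 = 0" if "\<eta> \<in> lobatto_nodes (Suc n)" "\<eta> \<noteq> \<xi>" for \<eta>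
        using that I(1) by (auto simp: lobatto_nodes_Suc g0)
    qed
  next
    case False
    then have \<xi>: "\<xi>\<^sup>2 = 1" "\<xi> = 1 \<or> \<xi> = -1" using \<xi> by (auto simp: lobatto_nodes_Suc)
    let ?A = "interior_nodes n"
    \<comment> \<open>The linear factor vanishes only at the opposite end point. A square there
      would exceed the degree of exactness; this choice reaches 2n - 1 exactly.\<close>
    have "degree ([:1, \<xi>:] * (g ?A)\<^sup>2) \<le> 1 + degree ((g ?A)\<^sup>2)"
      by (rule order.trans[OF degree_mult_le]) simp
    also have "degree ((g ?A)\<^sup>2) \<le> 2 * (n - 1)"
      by (rule order.trans[OF degree_power_le]) (use I in \<open>simp add: deg_g\<close>)
    finally have deg: "degree ([:1, \<xi>:] * (g ?A)\<^sup>2) \<le> 2 * n - 1" using n by simp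
    have val: "poly ([:1, \<xi>:] * (g ?A)\<^sup>2) t = (1 + t * \<xi>) * (poly (g ?A) t)\<^sup>2" for t
      by (simp add: algebra_simps)
    show ?thesis
    proof (rule *[OF deg]; unfold val)
      show "0 \<le> (1 + t * \<xi>) * (poly (g ?A) t)\<^sup>2" if "t \<in> {-1..1}" for t
        using that \<xi>(2) by (intro mult_nonneg_nonneg) auto
      show "0 < (1 + \<xi> * \<xi>) * (poly (g ?A) \<xi>)\<^sup>2"
        unfolding power2_eq_square[of \<xi>, symmetric] using \<xi>(1) I(1) False by (simp add: g0)
      show "(1 + \<eta> * \<xi>) * (poly (g ?A) \<eta>)\<^sup>2 = 0" if "\<eta> \<in> lobatto_nodes (Suc n)" "\<eta> \<noteq> \<xi>" for \<eta>
        using that I(1) \<xi>(2) by (auto simp: lobatto_nodes_Suc g0)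
    qed
  qed
qed

lemma lobatto_nodes_uminus: "uminus ` lobatto_nodes (Suc n) = lobatto_nodes (Suc n)"
proof -
  have *: "- x \<in> lobatto_nodes (Suc n)" if "x \<in> lobatto_nodes (Suc n)" for x
    using that by (auto simp: lobatto_nodes_Suc interior_nodes_def rodrigues_minus)
  have "x \<in> uminus ` lobatto_nodes (Suc n)" if "x \<in> lobatto_nodes (Suc n)" for x
    by (rule image_eqI[OF _ *[OF that]]) simp
  with * show ?thesis by blast
qed

lemma lobatto_weight_uminus: "lobatto_weight (Suc n) (- \<xi>) = lobatto_weight (Suc n) \<xi>"
proof -
  let ?X = "lobatto_nodes (Suc n)"
  have "?X - {- \<xi>} = uminus ` (?X - {\<xi>})"
    by (simp add: image_set_diff lobatto_nodes_uminus)
  \<comment> \<open>For \<open>\<xi> = \<eta>\<close> both sides are 0, since division by 0 gives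
    0.\<close>
  moreover have "(t - - \<eta>) / (- \<xi> - - \<eta>) = (- t - \<eta>) / (\<xi> - \<eta>)" for t \<eta>
    by (cases "\<xi> = \<eta>") (simp_all add: field_simps)
  ultimately have "(\<Prod>\<eta>\<in>?X - {- \<xi>}. (t - \<eta>) / (- \<xi> - \<eta>)) = (\<Prod>\<eta>\<in>?X - {\<xi>}. (- t - \<eta>) / (\<xi> - \<eta>))" for t
    by (simp only: prod.reindex[OF inj_uminus] o_def)
  then have "lobatto_weight (Suc n) (- \<xi>)
      = 1 / 2 * integral {-1..1} (\<lambda>t. \<Prod>\<eta>\<in>?X - {\<xi>}. (- t - \<eta>) / (\<xi> - \<eta>))"
    unfolding lobatto_weight_def by (simp only:)
  also have "\<dots> = lobatto_weight (Suc n) \<xi>"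
    using Henstock_Kurzweil_Integration.integral_reflect_real
      [of 1 "-1" "\<lambda>t. \<Prod>\<eta>\<in>?X - {\<xi>}. (t - \<eta>) / (\<xi> - \<eta>)"]
    unfolding lobatto_weight_def minus_minus by (simp only:)
  finally show ?thesis .
qed


section \<open>The cell-averaged update\<close>

lemma lobatto_exact_interval:
  assumes n: "n \<ge> 1" "degree p \<le> 2 * n - 1" and ab: "a < b"
  shows "(poly p has_integral
      (b - a) * (\<Sum>\<xi>\<in>lobatto_nodes (Suc n). lobatto_weight (Suc n) \<xi> * poly p (a + (b - a) * (\<xi> + 1) / 2))) {a..b}"
proof -
  define m c where "m = (b - a) / 2" and "c = (a + b) / 2"
  have m: "m > 0" using ab by (simp add: m_def)
  have "a - c = - m" "b - c = m" by (simp_all add: m_def c_def field_simps)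
  then have box: "(a - c) /\<^sub>R m = -1" "(b - c) /\<^sub>R m = 1" using m by simp_all
  have node: "m * \<xi> + c = a + (b - a) * (\<xi> + 1) / 2" for \<xi>
    by (simp add: m_def c_def field_simps)
  have I: "(poly p has_integral integral {a..b} (poly p)) (cbox a b)"
    by (simp add: integrable_integral)
  have "((\<lambda>x. poly p (m *\<^sub>R x + c)) has_integral integral {a..b} (poly p) /\<^sub>R m ^ DIM(real)) (cbox (-1) 1)"
    using has_integral_affinity'[OF I m, of c] by (simp only: box)
  moreover have "poly p (m *\<^sub>R x + c) = poly (pcompose p [:c, m:]) x" for x
    by (simp add: poly_pcompose add.commute mult.commute)
  ultimately have "integral {-1..1} (poly (pcompose p [:c, m:])) = integral {a..b} (poly p) / m"
    by (simp add: integral_unique divide_inverse mult.commute)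
  then have "integral {a..b} (poly p) = m * integral {-1..1} (poly (pcompose p [:c, m:]))"
    using m by simp
  \<comment> \<open>The Jacobian is half the length; the factor 1/2 goes into the weights with sum
    1.\<close>
  also have "\<dots> = (b - a) * (1 / 2 * integral {-1..1} (poly (pcompose p [:c, m:])))"
    by (simp add: m_def)
  also have "degree (pcompose p [:c, m:]) \<le> 2 * n - 1"
    using n m by (simp add: degree_pcompose)
  note lobatto_exact[OF n(1) this]
  finally show ?thesis
    using integrable_integral[OF integrable_poly[of p a b]]
    by (simp add: poly_pcompose node[symmetric] add.commute mult.commute)
qed

text \<open>A continuous extension of the piece on one cell to the whole line; its values at the
  cell ends are the one-sided limits of the discontinuous function.\<close>

definition poly_curve :: "('a :: euclidean_space \<Rightarrow> real poly) \<Rightarrow> real \<Rightarrow> 'a" where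
  "poly_curve Q x = (\<Sum>b\<in>Basis. poly (Q b) x *\<^sub>R b)"

lemma continuous_poly_curve: "isCont (poly_curve Q) x"
  unfolding poly_curve_def[abs_def] by (intro continuous_intros)

lemma componentwise_poly_onE:
  assumes "componentwise_poly_on k I U"
  obtains Q where "\<And>b. b \<in> Basis \<Longrightarrow> degree (Q b) \<le> k" "\<And>x. x \<in> I \<Longrightarrow> U x = poly_curve Q x"
proof -
  obtain Q where Q: "\<forall>b\<in>Basis. degree (Q b) \<le> k \<and> (\<forall>x\<in>I. U x \<bullet> b = poly (Q b) x)"
    using assms unfolding componentwise_poly_on_def by (elim bchoice[THEN exE])
  have "U x = poly_curve Q x" if "x \<in> I" for x
    by (rule euclidean_eqI) (use Q that in \<open>simp add: poly_curve_def inner_sum_left inner_Basis if_distrib cong: if_cong\<close>)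
  with Q show ?thesis by (intro that) auto
qed

lemma poly_curve_quadrature:
  fixes Q :: "'a :: euclidean_space \<Rightarrow> real poly"
  assumes n: "n \<ge> 1" and deg: "\<And>b. b \<in> Basis \<Longrightarrow> degree (Q b) \<le> 2 * n - 1" and ab: "a < b"
  shows "(poly_curve Q has_integral (b - a) *\<^sub>R
      (\<Sum>\<xi>\<in>lobatto_nodes (Suc n). lobatto_weight (Suc n) \<xi> *\<^sub>R poly_curve Q (a + (b - a) * (\<xi> + 1) / 2))) {a..b}"
proof -
  let ?X = "lobatto_nodes (Suc n)" and ?w = "lobatto_weight (Suc n)" and ?y = "\<lambda>\<xi>. a + (b - a) * (\<xi> + 1) / 2"
  have "(poly_curve Q has_integral
      (\<Sum>c\<in>Basis. ((b - a) * (\<Sum>\<xi>\<in>?X. ?w \<xi> * poly (Q c) (?y \<xi>))) *\<^sub>R c)) {a..b}"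
    unfolding poly_curve_def[abs_def]
    by (intro has_integral_sum has_integral_scaleR_left lobatto_exact_interval n ab deg) auto
  also have "(\<Sum>c\<in>Basis. ((b - a) * (\<Sum>\<xi>\<in>?X. ?w \<xi> * poly (Q c) (?y \<xi>))) *\<^sub>R c)
      = (b - a) *\<^sub>R (\<Sum>\<xi>\<in>?X. ?w \<xi> *\<^sub>R poly_curve Q (?y \<xi>))"
    unfolding poly_curve_def scaleR_sum_right scaleR_sum_left sum_distrib_left
    by (subst sum.swap) (simp add: mult.assoc)
  finally show ?thesis .
qed

lemma Lim_within_interval_eq:
  fixes q U :: "real \<Rightarrow> 'a :: t2_space"
  assumes "a < b" "y \<in> {a..b}" "isCont q y" and U: "\<And>x. x \<in> {a<..<b} \<Longrightarrow> U x = q x"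
  shows "Lim (at y within {a<..<b}) U = q y"
proof (rule tendsto_Lim)
  \<comment> \<open>\<open>Lim\<close> is defined by a description, so it is determined only where
    the limit is unique; the filter must be nontrivial.\<close>
  have "y islimpt {a<..<b}"
  proof (cases "y = b")
    case False
    then show ?thesis
      using assms(2) by (intro islimpt_subset[OF islimpt_greaterThanLessThan1[of y b]]) auto
  qed (use assms(1) in \<open>simp add: islimpt_greaterThanLessThan2\<close>)
  then show "\<not> trivial_limit (at y within {a<..<b})" by (simp add: trivial_limit_within)
  have "(q \<longlongrightarrow> q y) (at y within {a<..<b})"
    using assms(3) by (simp add: continuous_at_imp_continuous_at_within continuous_within[symmetric])
  moreover have "\<forall>\<^sub>F x in at y within {a<..<b}. U x = q x"
    using U by (simp add: eventually_at_filter)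
  ultimately show "(U \<longlongrightarrow> q y) (at y within {a<..<b})"
    by (simp add: tendsto_cong)
qed

lemma convex_sum_split:
  fixes s :: "'i \<Rightarrow> 'a :: real_vector"
  assumes "convex G" "finite X" "e \<in> X" and w: "\<And>x. x \<in> X \<Longrightarrow> w x \<ge> 0" "sum w X = 1" "w e < 1"
    and s: "\<And>x. x \<in> X \<Longrightarrow> s x \<in> G"
  obtains R where "R \<in> G" "(\<Sum>x\<in>X. w x *\<^sub>R s x) = w e *\<^sub>R s e + (1 - w e) *\<^sub>R R"
proof
  let ?R = "\<Sum>x\<in>X - {e}. (w x / (1 - w e)) *\<^sub>R s x"
  have "sum w (X - {e}) = 1 - w e" using assms by (simp add: sum_diff1)
  then show "?R \<in> G"
    using assms by (intro convex_sum) (auto simp: sum_divide_distrib[symmetric])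
  show "(\<Sum>x\<in>X. w x *\<^sub>R s x) = w e *\<^sub>R s e + (1 - w e) *\<^sub>R ?R"
    using assms(2,3) w(3) by (simp add: sum.remove[of X e] scaleR_sum_right)
qed

text \<open>\<open>y\<close> is the end of the half-cell at which \<open>U\<close> has the value of
  the polynomial piece. All other nodes, including the end where \<open>U\<close> may jump, are
  collected in the one state \<open>R\<close>.\<close>

lemma half_cell_average:
  assumes n: "n \<ge> 1" and k: "k \<le> 2 * n - 1" and ab: "a < b" and end_point: "y \<in> {a, b}"
    and poly: "componentwise_poly_on k I U" "{a<..<b} \<subseteq> I" "y \<in> I"
    and adm: "admissible_at_nodes (Suc n) U a b"
  defines "w \<equiv> lobatto_weight (Suc n) (-1)"
  shows "U y \<in> admissible \<and> w < 1 \<and>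
    (\<exists>R\<in>admissible. (U has_integral (b - a) *\<^sub>R (w *\<^sub>R U y + (1 - w) *\<^sub>R R)) {a..b})"
proof -
  let ?X = "lobatto_nodes (Suc n)" and ?w = "lobatto_weight (Suc n)"
  define node where "node \<xi> = a + (b - a) * (\<xi> + 1) / 2" for \<xi>
  note X = lobatto_nodes_props[OF n]
  obtain e where e: "e \<in> {-1, 1}" and y_node: "y = node e"
  proof -
    have "node (-1) = a" "node 1 = b" by (simp_all add: node_def field_simps)
    then show thesis using end_point that by blast
  qed
  obtain Q where Q: "\<And>b. b \<in> Basis \<Longrightarrow> degree (Q b) \<le> k" "\<And>x. x \<in> I \<Longrightarrow> U x = poly_curve Q x"
    by (rule componentwise_poly_onE[OF poly(1)]; rule that)
  have deg: "degree (Q c) \<le> 2 * n - 1" if "c \<in> Basis" for c using Q(1)[OF that] k by simp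
  have Uq: "U x = poly_curve Q x" if "x \<in> {a<..<b}" for x using Q(2) poly(2) that by blast
  have G: "poly_curve Q (node \<xi>) \<in> admissible" if "\<xi> \<in> ?X" for \<xi>
  proof -
    have "-1 \<le> \<xi>" "\<xi> \<le> 1" using that X(3) by auto
    then have "0 \<le> (b - a) * (\<xi> + 1)" using ab by simp
    moreover have "(b - a) * (\<xi> + 1) \<le> (b - a) * 2"
      using \<open>\<xi> \<le> 1\<close> ab by (intro mult_left_mono) auto
    ultimately have "node \<xi> \<in> {a..b}" by (simp add: node_def)
    with ab have "Lim (at (node \<xi>) within {a<..<b}) U = poly_curve Q (node \<xi>)"
      by (intro Lim_within_interval_eq continuous_poly_curve Uq)
    moreover have "node \<xi> \<in> quad_nodes (Suc n) a b" using that unfolding quad_nodes_def node_def by (rule imageI)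
    ultimately show ?thesis using adm unfolding admissible_at_nodes_def by metis
  qed
  have eX: "-1 \<in> ?X" "1 \<in> ?X" "e \<in> ?X" using e by (auto simp: lobatto_nodes_def)
  have we: "?w e = w" "?w 1 = w" using e lobatto_weight_uminus[of n 1] by (auto simp: w_def)
  \<comment> \<open>Both end points have weight \<open>w\<close>, so 2w <= 1.\<close>
  have "sum ?w {-1, 1} \<le> sum ?w ?X"
    using eX X(1) lobatto_weight_nonneg[OF n] by (intro sum_mono2) auto
  then have "w < 1" using lobatto_weight_sum[OF n] we by (simp add: w_def)
  obtain R where R: "R \<in> admissible"
    "(\<Sum>\<xi>\<in>?X. ?w \<xi> *\<^sub>R poly_curve Q (node \<xi>)) = w *\<^sub>R poly_curve Q y + (1 - w) *\<^sub>R R"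
    using convex_sum_split[OF convex_admissible X(1) eX(3), of ?w "\<lambda>\<xi>. poly_curve Q (node \<xi>)"]
      lobatto_weight_nonneg[OF n] lobatto_weight_sum[OF n] \<open>w < 1\<close> G
    unfolding we y_node by blast
  have y: "U y = poly_curve Q y" using Q(2) poly(3) by simp
  have "(poly_curve Q has_integral (b - a) *\<^sub>R (\<Sum>\<xi>\<in>?X. ?w \<xi> *\<^sub>R poly_curve Q (node \<xi>))) {a..b}"
    unfolding node_def using n deg ab by (rule poly_curve_quadrature)
  then have "(poly_curve Q has_integral (b - a) *\<^sub>R (w *\<^sub>R U y + (1 - w) *\<^sub>R R)) {a..b}"
    unfolding R(2) y .
  then have "(U has_integral (b - a) *\<^sub>R (w *\<^sub>R U y + (1 - w) *\<^sub>R R)) {a..b}"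
    using has_integral_spike_interior[of "poly_curve Q" _ a b U] Uq by simp
  moreover have "U y \<in> admissible" using G[OF eX(3)] unfolding y unfolding y_node .
  ultimately show ?thesis using R(1) \<open>w < 1\<close> by blast
qed

text \<open>With \<open>\<lambda> = dt/dx\<close> and \<open>a = \<theta> w / (2 \<lambda>)\<close>, the update equals
  \<open>(1 - \<theta>) V + \<theta> (w W + (1 - w) (R\<^sub>1 + R\<^sub>2) / 2)\<close>, where \<open>W\<close> is the Lax--Friedrichs splitting of
  the two end point values for the speed \<open>a\<close>.\<close>

lemma central_update_admissible:
  assumes "eos p" and n: "n \<ge> 1" and k: "k \<le> 2 * n - 1"
    and mesh: "l < m" "m - l = dx / 2" "r - m = dx / 2"
    and polyl: "componentwise_poly_on k Il U" "{l<..<m} \<subseteq> Il" "l \<in> Il"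
    and polyr: "componentwise_poly_on k Ir U" "{m<..<r} \<subseteq> Ir" "r \<in> Ir"
    and adm: "admissible_at_nodes (Suc n) U l m" "admissible_at_nodes (Suc n) U m r"
    and V: "V \<in> admissible" and B: "magnetic (U r) $ i = magnetic (U l) $ i"
    and dt: "dt > 0" "\<theta> = dt / \<tau>" "0 < \<theta>" "\<theta> \<le> 1"
    and cfl: "wave_speed p i (U r) (U l) * (dt / dx) < \<theta> * lobatto_weight (Suc n) (-1) / 2"
  shows "V + dt *\<^sub>R ((1 / \<tau>) *\<^sub>R (cell_average dx {l<..<r} U - V)
      - (1 / dx) *\<^sub>R (flux p i (U r) - flux p i (U l))) \<in> admissible"
proof -
  have "\<tau> \<noteq> 0" using dt by auto
  have dx: "dx > 0" and "m < r" using mesh by auto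
  define w where "w = lobatto_weight (Suc n) (-1)"
  obtain R1 where 1: "U l \<in> admissible" "w < 1" "R1 \<in> admissible"
    "(U has_integral (dx / 2) *\<^sub>R (w *\<^sub>R U l + (1 - w) *\<^sub>R R1)) {l..m}"
    using half_cell_average[OF n k mesh(1) insertI1 polyl adm(1)] unfolding w_def mesh(2) by blast
  obtain R2 where 2: "U r \<in> admissible" "R2 \<in> admissible"
    "(U has_integral (dx / 2) *\<^sub>R (w *\<^sub>R U r + (1 - w) *\<^sub>R R2)) {m..r}"
    using half_cell_average[OF n k \<open>m < r\<close> insertI2[OF singletonI] polyr adm(2)]
    unfolding w_def mesh(3) by blast
  define W where "W a = (1 / 2) *\<^sub>R (U r + U l - (1 / a) *\<^sub>R (flux p i (U r) - flux p i (U l)))" for a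
  \<comment> \<open>With this \<open>a\<close> the flux difference in \<open>W a\<close>, weighted
    by \<open>\<theta> * w\<close>, has coefficient \<open>dt / dx\<close>, and the CFL condition
    says that \<open>a\<close> exceeds the wave speed.\<close>
  define a where "a = \<theta> * w * dx / (2 * dt)"
  have "a * (dt / dx) = \<theta> * w / 2" using dx dt(1) by (simp add: a_def)
  then have "wave_speed p i (U r) (U l) * (dt / dx) < a * (dt / dx)"
    using cfl unfolding w_def by (simp only:)
  then have ws: "wave_speed p i (U r) (U l) < a"
    by (rule mult_right_less_imp_less) (use dx dt(1) in simp)
  have "0 \<le> wave_speed p i (U r) (U l)"
    using 1 2 by (intro wave_speed_nonneg) (auto simp: admissible_def)
  with ws have "a > 0" by linarith
  \<comment> \<open>Strict positivity of the end point weight is read off from the CFL condition, as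
    \<open>a\<close> exceeds a nonnegative speed.\<close>
  then have "w > 0" using dx dt by (simp add: a_def zero_less_mult_iff zero_less_divide_iff)
  have W: "W a \<in> admissible"
    unfolding W_def using \<open>eos p\<close> 2(1) 1(1) B ws by (rule Lax_Friedrichs_splitting_admissible)
  have "(U has_integral (dx / 2) *\<^sub>R (w *\<^sub>R U l + (1 - w) *\<^sub>R R1)
      + (dx / 2) *\<^sub>R (w *\<^sub>R U r + (1 - w) *\<^sub>R R2)) {l..r}"
    using mesh \<open>m < r\<close> 1 2 by (intro has_integral_combine[of l m r]) auto
  then have "integral {l<..<r} U = (dx / 2) *\<^sub>R (w *\<^sub>R U l + (1 - w) *\<^sub>R R1)
      + (dx / 2) *\<^sub>R (w *\<^sub>R U r + (1 - w) *\<^sub>R R2)"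
    by (simp add: integral_unique integral_open_interval_real[symmetric])
  then have A: "cell_average dx {l<..<r} U
      = (1 / 2) *\<^sub>R (w *\<^sub>R U l + (1 - w) *\<^sub>R R1 + (w *\<^sub>R U r + (1 - w) *\<^sub>R R2))"
    using dx by (simp add: cell_average_def scaleR_add_right)
  have "V + dt *\<^sub>R ((1 / \<tau>) *\<^sub>R (cell_average dx {l<..<r} U - V)
        - (1 / dx) *\<^sub>R (flux p i (U r) - flux p i (U l)))
      = V + \<theta> *\<^sub>R (cell_average dx {l<..<r} U - V)
        - (\<theta> * w * (1 / 2) * (1 / a)) *\<^sub>R (flux p i (U r) - flux p i (U l))"
    using dt dx \<open>w > 0\<close> \<open>\<tau> \<noteq> 0\<close> by (simp add: scaleR_diff_right a_def)
  also have "\<dots> = (1 - \<theta>) *\<^sub>R V + \<theta> *\<^sub>R (w *\<^sub>R W a + (1 - w) *\<^sub>R ((1 / 2) *\<^sub>R R1 + (1 / 2) *\<^sub>R R2))"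
    unfolding A W_def by (simp add: algebra_simps diff_divide_distrib)
  also have "\<dots> \<in> admissible"
    using dt \<open>w > 0\<close> 1 2 W V by (intro convexD[OF convex_admissible]) auto
  finally show ?thesis .
qed

text \<open>Both updates are one lemma on meshes shifted by half a cell: the primal one reads
  \<open>UD\<close>, which breaks at the centre of a primal cell, the dual one reads
  \<open>UC\<close>, which breaks at the centre of a dual cell.\<close>

theorem theorem3p1:
  fixes p :: "real \<Rightarrow> real \<Rightarrow> real"
    and k L :: nat
    and N :: int
    and x\<^sub>0 dx dt \<tau> \<theta> Bconst :: real
    and UC UD :: "real \<Rightarrow> state"
  assumes eos: "eos p"
    and k: "k \<ge> 1"
    and L: "L = nat \<lceil>(real k + 3) / 2\<rceil>"
    and mesh: "N \<ge> 1" "dx > 0"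
    and polyC: "\<forall>j\<in>{0..N+1}. componentwise_poly_on k (primal_cell x\<^sub>0 dx j) UC"
    and polyD: "\<forall>j\<in>{0..N}. componentwise_poly_on k (dual_cell x\<^sub>0 dx j) UD"
    and avgC: "\<forall>j\<in>{1..N}. cell_average dx (primal_cell x\<^sub>0 dx j) UC \<in> admissible"
    and avgD: "\<forall>j\<in>{0..N}. cell_average dx (dual_cell x\<^sub>0 dx j) UD \<in> admissible"
    and nodes: "\<forall>j\<in>{1..N}. \<forall>U\<in>{UC, UD}.
        admissible_at_nodes L U (grid x\<^sub>0 dx (j - 1/2)) (grid x\<^sub>0 dx j) \<and>
        admissible_at_nodes L U (grid x\<^sub>0 dx j) (grid x\<^sub>0 dx (j + 1/2))"
    and ghost_nodes:
        "admissible_at_nodes L UC (grid x\<^sub>0 dx 0) (grid x\<^sub>0 dx (1/2))"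
        "admissible_at_nodes L UC (grid x\<^sub>0 dx (N + 1/2)) (grid x\<^sub>0 dx (N + 1))"
    and B1_D: "\<forall>j\<in>{1..N}. magnetic (UD (grid x\<^sub>0 dx (j - 1/2))) $ 1 = Bconst \<and>
                           magnetic (UD (grid x\<^sub>0 dx (j + 1/2))) $ 1 = Bconst"
    and B1_C: "\<forall>j\<in>{0..N+1}. magnetic (UC (grid x\<^sub>0 dx j)) $ 1 = Bconst"
    and dt: "dt > 0" and \<tau>: "\<tau> > 0"
    and \<theta>: "\<theta> = dt / \<tau>" "0 < \<theta>" "\<theta> \<le> 1"
    and cfl: "max_wave_speed p x\<^sub>0 dx N UC UD * (dt / dx) < \<theta> * lobatto_weight L (-1) / 2"
  shows "(\<forall>j\<in>{1..N}. cell_average dx (primal_cell x\<^sub>0 dx j) UC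
                       + dt *\<^sub>R cdg_primal p x\<^sub>0 dx \<tau> UC UD j \<in> admissible) \<and>
         (\<forall>j\<in>{0..N}. cell_average dx (dual_cell x\<^sub>0 dx j) UD
                       + dt *\<^sub>R cdg_dual p x\<^sub>0 dx \<tau> UD UC j \<in> admissible)"
proof -
  define n where "n = L - 1"
  \<comment> \<open>The rule with L = n + 1 points is exact to degree 2n - 1 = 2L - 3; the ceiling
    ensures that this is at least \<open>k\<close>.\<close>
  have "(real k + 3) / 2 \<le> real L" unfolding L by linarith
  then have "real (k + 3) \<le> real (2 * L)" by simp
  then have "k + 3 \<le> 2 * L" unfolding of_nat_le_iff .
  then have Ln: "L = Suc n" and n: "n \<ge> 1" "k \<le> 2 * n - 1" using k by (auto simp: n_def)
  note update = central_update_admissible[OF eos n, where i = 1 and \<theta> = \<theta> and \<tau> = \<tau> and dt = dt,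
      folded Ln]
  let ?speeds = "(\<lambda>j::int. wave_speed p 1 (UC (grid x\<^sub>0 dx (j + 1))) (UC (grid x\<^sub>0 dx j))) ` {0..N} \<union>
          (\<lambda>j::int. wave_speed p 1 (UD (grid x\<^sub>0 dx (j + 1/2))) (UD (grid x\<^sub>0 dx (j - 1/2)))) ` {1..N}"
  have speed: "s * (dt / dx) < \<theta> * lobatto_weight L (-1) / 2" if "s \<in> ?speeds" for s
  proof -
    have "s \<le> max_wave_speed p x\<^sub>0 dx N UC UD"
      unfolding max_wave_speed_def using that by (intro Max_ge) auto
    then have "s * (dt / dx) \<le> max_wave_speed p x\<^sub>0 dx N UC UD * (dt / dx)"
      using dt mesh by (intro mult_right_mono) auto
    with cfl show ?thesis by linarith
  qed
  have "cell_average dx (primal_cell x\<^sub>0 dx j) UC + dt *\<^sub>R cdg_primal p x\<^sub>0 dx \<tau> UC UD j \<in> admissible"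
    if j: "j \<in> {1..N}" for j
    unfolding cdg_primal_def primal_cell_def[of _ _ j]
  proof (rule update[where Il = "dual_cell x\<^sub>0 dx (j - 1)" and Ir = "dual_cell x\<^sub>0 dx j"
        and m = "grid x\<^sub>0 dx j"])
    show "componentwise_poly_on k (dual_cell x\<^sub>0 dx (j - 1)) UD"
      "componentwise_poly_on k (dual_cell x\<^sub>0 dx j) UD"
      using polyD j by auto
    show "admissible_at_nodes L UD (grid x\<^sub>0 dx (j - 1/2)) (grid x\<^sub>0 dx j)"
      "admissible_at_nodes L UD (grid x\<^sub>0 dx j) (grid x\<^sub>0 dx (j + 1/2))"
      using nodes j by auto
    show "cell_average dx {grid x\<^sub>0 dx (j - 1/2)<..<grid x\<^sub>0 dx (j + 1/2)} UC \<in> admissible"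
      using avgC j unfolding primal_cell_def by auto
    show "magnetic (UD (grid x\<^sub>0 dx (j + 1/2))) $ 1 = magnetic (UD (grid x\<^sub>0 dx (j - 1/2))) $ 1"
      using B1_D j by simp
    show "wave_speed p 1 (UD (grid x\<^sub>0 dx (j + 1/2))) (UD (grid x\<^sub>0 dx (j - 1/2))) * (dt / dx)
        < \<theta> * lobatto_weight L (-1) / 2"
      using j by (intro speed) blast
  qed (use dt \<theta> mesh(2) in \<open>auto simp: dual_cell_def grid_def algebra_simps\<close>)
  moreover have "cell_average dx (dual_cell x\<^sub>0 dx j) UD + dt *\<^sub>R cdg_dual p x\<^sub>0 dx \<tau> UD UC j \<in> admissible"
    if j: "j \<in> {0..N}" for j
    unfolding cdg_dual_def dual_cell_def
  proof (rule update[where Il = "primal_cell x\<^sub>0 dx j" and Ir = "primal_cell x\<^sub>0 dx (j + 1)"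
        and m = "grid x\<^sub>0 dx (j + 1/2)"])
    show "componentwise_poly_on k (primal_cell x\<^sub>0 dx j) UC"
      "componentwise_poly_on k (primal_cell x\<^sub>0 dx (j + 1)) UC"
      using polyC j by auto
    \<comment> \<open>The left half of dual cell 0 and the right half of dual cell \<open>N\<close>
      lie in ghost cells, hence the case distinctions here and below.\<close>
    show "admissible_at_nodes L UC (grid x\<^sub>0 dx j) (grid x\<^sub>0 dx (j + 1/2))"
      using nodes ghost_nodes(1) j by (cases "j = 0") auto
    have "grid x\<^sub>0 dx (real_of_int (j + 1) - 1/2) = grid x\<^sub>0 dx (j + 1/2)"
      "grid x\<^sub>0 dx (real_of_int (j + 1)) = grid x\<^sub>0 dx (j + 1)"
      by (simp_all add: grid_def field_simps)
    moreover have "admissible_at_nodes L UC (grid x\<^sub>0 dx (real_of_int (j + 1) - 1/2)) (grid x\<^sub>0 dx (real_of_int (j + 1)))"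
      if "j \<noteq> N" using nodes[rule_format, of "j + 1" UC] j that by auto
    ultimately show "admissible_at_nodes L UC (grid x\<^sub>0 dx (j + 1/2)) (grid x\<^sub>0 dx (j + 1))"
      using ghost_nodes(2) by (cases "j = N") simp_all
    show "cell_average dx {grid x\<^sub>0 dx j<..<grid x\<^sub>0 dx (j + 1)} UD \<in> admissible"
      using avgD j unfolding dual_cell_def by auto
    have "magnetic (UC (grid x\<^sub>0 dx (real_of_int (j + 1)))) $ 1 = Bconst"
      using B1_C j by (intro B1_C[rule_format]) auto
    then show "magnetic (UC (grid x\<^sub>0 dx (j + 1))) $ 1 = magnetic (UC (grid x\<^sub>0 dx j)) $ 1"
      using B1_C j by simp
    show "wave_speed p 1 (UC (grid x\<^sub>0 dx (j + 1))) (UC (grid x\<^sub>0 dx j)) * (dt / dx)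
        < \<theta> * lobatto_weight L (-1) / 2"
      using j by (intro speed UnI1 image_eqI[of _ _ j]) simp_all
  qed (use dt \<theta> mesh(2) in \<open>auto simp: primal_cell_def grid_def algebra_simps\<close>)
  ultimately show ?thesis by blast
qed

end
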